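(* Let $\mathcal{M}_2$ be the set of graphs in $\mathcal{B}_0$ without isolated vertices. In $\mathbb{R}^{\mathcal{M}_2}$ with the product topology, the closure of the set $$\{(h(H,G))_{H\in\mathcal{M}_2}\ :\ G\in\mathcal{B}_0 \text{ is edge-vertex transitive}\}$$ is equal to $\mathcal{L}^*$.
   Context: Bipartite setting. $\mathcal{B}$ is the set of (isomorphism classes of) finite graphs $H$ whose vertex set is partitioned into two labelled classes $V_1(H),V_2(H)$, with edge set $E(H)\subseteq V_1(H)\times V_2(H)$. Homomorphisms and automorphisms preserve the labels $1,2$; $\mathrm{Hom}(H,G)$ is the set of homomorphisms from $H$ to $G$. $\mathcal{B}_0$ is the set of $G\in\mathcal{B}$ with $E(G)\neq\emptyset$. $P_1$ is the single edge. For $H\in\mathcal{B}$, $G\in\mathcal{B}_0$ put $t(H,G)=|\mathrm{Hom}(H,G)|\,|V_1(G)|^{-|V_1(H)|}|V_2(G)|^{-|V_2(H)|}$, $d(H,G)=-\log t(H,G)$, and, for $H,G\in\mathcal{B}_0$, $h(H,G)=d(H,G)/d(P_1,G)$; if $E(G)=V_1(G)\times V_2(G)$ (so $d(P_1,G)=0$), set $h(H,G):=|E(H)|$. A graph $G\in\mathcal{B}_0$ is edge-vertex transitive if its (label preserving) automorphism group acts transitively on $E(G)$, on $V_1(G)$ and on $V_2(G)$. Information-theoretic quantities. Let $X=(X_1,X_2)$ be a joint distribution with $X_i$ taking values in a finite set $F_i$ (a "finite joint distribution"), and let $H\in\mathcal{M}_2$. $Q(H,X)$ is the (non-empty) set of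 all joint distributions $\{X_v\}_{v\in V(H)}$, with $X_v$ taking values in $F_i$ for $v\in V_i(H)$, such that for every edge $(v,w)\in E(H)$ (with $v\in V_1(H)$, $w\in V_2(H)$) the pair $(X_v,X_w)$ has the same distribution as $(X_1,X_2)$. $\mathbb{H}$ denotes Shannon entropy (natural logarithm). $m(H,X)$ is the maximal entropy of an element of $Q(H,X)$, $d^*(H,X):=-m(H,X)+\sum_{i=1}^2|V_i(H)|\,\mathbb{H}(X_i)$, and $h^*(H,X):=d^*(H,X)/d^*(P_1,X)$; if $X_1,X_2$ are independent, set $h^*(H,X):=|E(H)|$. $\mathcal{L}^*\subseteq\mathbb{R}^{\mathcal{M}_2}$ is the set of functions $f:\mathcal{M}_2\to\mathbb{R}$ for which there is a sequence $\{X^i\}_{i=1}^\infty$ of finite joint distributions of two random variables with $f(H)=\lim_{i\to\infty}h^*(H,X^i)$ for every $H\in\mathcal{M}_2$. *)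

theory Defs
  imports "HOL-Probability.Probability"
begin

text \<open>
  Every isomorphism class of finite bipartite graphs with labelled classes has a representative
  whose two classes are finite sets of natural numbers.  The classes \<open>V1\<close> and \<open>V2\<close> are two
  separate sorts, so they may share numbers, and a map on the vertices that preserves the labels
  is a pair of maps.  Functions of isomorphism classes are rendered as functions of these
  representatives: all the quantities below are isomorphism invariant, and the
  isomorphism-invariant functions form a closed subset of the product space, so that the
  multiplicity of representatives does not affect closures and pointwise limits.
\<close>

record bigraph =
  V1 :: "nat set"
  V2 :: "nat set"
  edges :: "(nat \<times> nat) set"

definition bigraphs :: "bigraph set" where
  "bigraphs = {G. finite (V1 G) \<and> finite (V2 G) \<and> edges G \<subseteq> V1 G \<times> V2 G}"

definition bigraphs0 :: "bigraph set" where
  "bigraphs0 = {G \<in> bigraphs. edges G \<noteq> {}}"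

definition no_isolated_vertices :: "bigraph \<Rightarrow> bool" where
  "no_isolated_vertices G \<longleftrightarrow>
     (\<forall>v\<in>V1 G. \<exists>w. (v, w) \<in> edges G) \<and> (\<forall>w\<in>V2 G. \<exists>v. (v, w) \<in> edges G)"

definition M2 :: "bigraph set" where
  "M2 = {G \<in> bigraphs0. no_isolated_vertices G}"

definition P1 :: bigraph where
  "P1 = \<lparr>V1 = {0}, V2 = {0}, edges = {(0, 0)}\<rparr>"

definition Hom :: "bigraph \<Rightarrow> bigraph \<Rightarrow> ((nat \<Rightarrow> nat) \<times> (nat \<Rightarrow> nat)) set" where
  "Hom H G = {(f, g). f \<in> V1 H \<rightarrow>\<^sub>E V1 G \<and> g \<in> V2 H \<rightarrow>\<^sub>E V2 G \<and>
                 (\<forall>(v, w)\<in>edges H. (f v, g w) \<in> edges G)}"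

definition hom_density :: "bigraph \<Rightarrow> bigraph \<Rightarrow> real" where
  "hom_density H G =
     real (card (Hom H G)) / (real (card (V1 G)) ^ card (V1 H) * real (card (V2 G)) ^ card (V2 H))"

definition d :: "bigraph \<Rightarrow> bigraph \<Rightarrow> real" where
  "d H G = - ln (hom_density H G)"

definition h :: "bigraph \<Rightarrow> bigraph \<Rightarrow> real" where
  "h H G = (if edges G = V1 G \<times> V2 G then real (card (edges H)) else d H G / d P1 G)"

definition Aut :: "bigraph \<Rightarrow> ((nat \<Rightarrow> nat) \<times> (nat \<Rightarrow> nat)) set" where
  "Aut G = {(f, g). bij_betw f (V1 G) (V1 G) \<and> bij_betw g (V2 G) (V2 G) \<and>
              (\<forall>v\<in>V1 G. \<forall>w\<in>V2 G. (f v, g w) \<in> edges G \<longleftrightarrow> (v, w) \<in> edges G)}"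

definition edge_vertex_transitive :: "bigraph \<Rightarrow> bool" where
  "edge_vertex_transitive G \<longleftrightarrow>
     (\<forall>(v, w)\<in>edges G. \<forall>(v', w')\<in>edges G. \<exists>(f, g)\<in>Aut G. f v = v' \<and> g w = w') \<and>
     (\<forall>v\<in>V1 G. \<forall>v'\<in>V1 G. \<exists>(f, g)\<in>Aut G. f v = v') \<and>
     (\<forall>w\<in>V2 G. \<forall>w'\<in>V2 G. \<exists>(f, g)\<in>Aut G. g w = w')"

text \<open>
  Shannon entropy (natural logarithm) of a distribution.  The law of a random variable is
  identified with a pmf, on which the variable itself is the identity map.
\<close>

definition shannon_entropy :: "'a pmf \<Rightarrow> real" where
  "shannon_entropy p = prob_space.entropy (measure_pmf p) (exp 1) (count_space UNIV) (\<lambda>x. x)"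

lemma shannon_entropy_eq_sum:
  assumes "finite (set_pmf p)"
  shows "shannon_entropy p = - (\<Sum>x\<in>set_pmf p. pmf p x * ln (pmf p x))"
proof -
  interpret information_space "measure_pmf p" "exp 1"
    by unfold_locales auto
  have "distributed (measure_pmf p) (count_space UNIV) (\<lambda>x. x) (pmf p)"
    by (simp add: distributed_def measure_pmf_eq_density[symmetric])
       (metis distr_id2 sets_measure_pmf_count_space)
  from entropy_distr[OF this]
  have "shannon_entropy p = - (\<integral>x. pmf p x * ln (pmf p x) \<partial>count_space UNIV)"
    by (simp add: shannon_entropy_def log_def)
  also have "(\<integral>x. pmf p x * ln (pmf p x) \<partial>count_space UNIV) =
      (\<Sum>x\<in>set_pmf p. pmf p x * ln (pmf p x))"
    using assms
    by (subst lebesgue_integral_count_space_finite_support)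
       (auto intro!: sum.mono_neutral_left finite_subset[of _ "set_pmf p"] simp: set_pmf_iff)
  finally show ?thesis .
qed

text \<open>
  A joint distribution of two random variables with values in the finite sets \<open>F1\<close> and \<open>F2\<close>;
  as only the distribution matters, the values are taken to be natural numbers.
\<close>

record joint_dist =
  F1 :: "nat set"
  F2 :: "nat set"
  law :: "(nat \<times> nat) pmf"

definition finite_joint_dists :: "joint_dist set" where
  "finite_joint_dists =
     {X. finite (F1 X) \<and> finite (F2 X) \<and> set_pmf (law X) \<subseteq> F1 X \<times> F2 X}"

abbreviation law1 :: "joint_dist \<Rightarrow> nat pmf" where
  "law1 X \<equiv> map_pmf fst (law X)"

abbreviation law2 :: "joint_dist \<Rightarrow> nat pmf" where
  "law2 X \<equiv> map_pmf snd (law X)"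

definition independent :: "joint_dist \<Rightarrow> bool" where
  "independent X \<longleftrightarrow>
     prob_space.indep_var (measure_pmf (law X)) (count_space UNIV) fst (count_space UNIV) snd"

text \<open>
  The vertices of \<open>H\<close> are \<open>Inl v\<close> for \<open>v \<in> V1 H\<close> and \<open>Inr w\<close> for \<open>w \<in> V2 H\<close>.  A joint
  distribution of a family indexed by the vertices is a distribution on functions that are
  \<open>undefined\<close> off the vertex set.
\<close>

definition Q :: "bigraph \<Rightarrow> joint_dist \<Rightarrow> (nat + nat \<Rightarrow> nat) pmf set" where
  "Q H X = {q. set_pmf q \<subseteq> (\<Pi>\<^sub>E x\<in>V1 H <+> V2 H. case x of Inl _ \<Rightarrow> F1 X | Inr _ \<Rightarrow> F2 X) \<and>
              (\<forall>(v, w)\<in>edges H. map_pmf (\<lambda>\<omega>. (\<omega> (Inl v), \<omega> (Inr w))) q = law X)}"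

text \<open>
  The supremum below is attained: \<open>Q H X\<close> is a non-empty compact set of distributions on a finite
  set, on which the entropy is continuous.
\<close>

definition m :: "bigraph \<Rightarrow> joint_dist \<Rightarrow> real" where
  "m H X = (SUP q\<in>Q H X. shannon_entropy q)"

definition dstar :: "bigraph \<Rightarrow> joint_dist \<Rightarrow> real" where
  "dstar H X = - m H X + (real (card (V1 H)) * shannon_entropy (law1 X)
                          + real (card (V2 H)) * shannon_entropy (law2 X))"

definition hstar :: "bigraph \<Rightarrow> joint_dist \<Rightarrow> real" where
  "hstar H X = (if independent X then real (card (edges H)) else dstar H X / dstar P1 X)"

text \<open>
  Functions on \<open>M2\<close> are represented as functions that are \<open>undefined\<close> outside \<open>M2\<close>, which is
  the carrier of the product topology on \<open>M2\<close>.
\<close>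

definition Lstar :: "(bigraph \<Rightarrow> real) set" where
  "Lstar = {f \<in> extensional M2.
     \<exists>X. (\<forall>i::nat. X i \<in> finite_joint_dists) \<and> (\<forall>H\<in>M2. (\<lambda>i. hstar H (X i)) \<longlonglongrightarrow> f H)}"

end

theory Submission
  imports Defs "HOL-Combinatorics.Multiset_Permutations" "HOL-Real_Asymp.Real_Asymp"
begin

text \<open>
  If \<open>G\<close> is edge-vertex transitive and \<open>X\<close> is a uniformly random edge of \<open>G\<close>, then a uniformly random
  homomorphism \<open>H \<rightarrow> G\<close> lies in \<open>Q H X\<close>, and every member of \<open>Q H X\<close> is supported on the
  homomorphisms.  Hence \<open>m H X\<close> is the logarithm of the number of homomorphisms, and
  \<open>hstar H X = h H G\<close>.

  Conversely, let \<open>X\<close> be a joint distribution with dependent components.  A multiset \<open>M\<close> of \<open>n\<close> pairs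
  approximating the law of \<open>X\<close> gives the type graph of \<open>M\<close>: its vertices are the sequences of length
  \<open>n\<close> whose type is one of the marginals of \<open>M\<close>, its edges the pairs of sequences of joint type \<open>M\<close>.
  The symmetric group acts transitively on vertices and edges.  Homomorphisms from \<open>H\<close> to the type
  graph are sequences of length \<open>n\<close> of vertex assignments whose type has all edge marginals equal to
  \<open>M\<close>.  There are at most polynomially many such types, and a type of entropy \<open>s\<close> is realised by
  \<open>exp (n * s)\<close> sequences up to a polynomial factor, so the number of homomorphisms is
  \<open>exp (n * m H X)\<close> up to a factor \<open>exp (o(n))\<close>.  The upper bound uses compactness.  For the lower
  bound one needs types close to optimal members of \<open>Q H X\<close>, for finitely many \<open>H\<close> at once, with
  exactly the same edge marginals \<open>M\<close>.  These come from Dirichlet's simultaneous approximation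
  theorem: rounding all probabilities multiplied by a common denominator \<open>n\<close> makes errors so small
  that the linear equations with integer coefficients between them survive exactly.
\<close>

section \<open>Closure in a product of real lines\<close>

text \<open>Basic open sets of the product restrict only finitely many coordinates, and finitely
  many radii have a common lower bound. Both inclusions of the main result use closeness in this
  form.\<close>

lemma in_closure_of_product_topology_real:
  assumes "S \<subseteq> extensional I"
  shows "f \<in> product_topology (\<lambda>_. euclideanreal) I closure_of S \<longleftrightarrow>
    f \<in> extensional I \<and>
    (\<forall>J \<epsilon>. finite J \<longrightarrow> J \<subseteq> I \<longrightarrow> 0 < \<epsilon> \<longrightarrow> (\<exists>g\<in>S. \<forall>i\<in>J. \<bar>g i - f i\<bar> < \<epsilon>))"
    (is "?L \<longleftrightarrow> ?R")
proof
  assume L: ?L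
  show ?R
  proof (intro conjI allI impI)
    show ext: "f \<in> extensional I"
      using L by (auto simp: in_closure_of PiE_UNIV_domain PiE_def)
    fix J and \<epsilon> :: real
    assume J: "finite J" "J \<subseteq> I" and \<epsilon>: "0 < \<epsilon>"
    define U where "U = (\<lambda>i. if i \<in> J then ball (f i) \<epsilon> else UNIV)"
    have "openin (product_topology (\<lambda>_. euclideanreal) I) (PiE I U)"
      by (subst openin_PiE_gen) (auto simp: U_def intro: finite_subset[OF _ J(1)])
    moreover have "f \<in> PiE I U"
      using ext \<epsilon> by (auto simp: U_def PiE_def)
    ultimately obtain g where "g \<in> S" "g \<in> PiE I U"
      using L unfolding in_closure_of by blast
    moreover have "\<bar>g i - f i\<bar> < \<epsilon>" if "i \<in> J" for i
    proof -
      have "g i \<in> U i"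
        using that J \<open>g \<in> PiE I U\<close> by (auto simp: PiE_def)
      then show ?thesis
        using that by (simp add: U_def dist_real_def abs_minus_commute)
    qed
    ultimately show "\<exists>g\<in>S. \<forall>i\<in>J. \<bar>g i - f i\<bar> < \<epsilon>" by blast
  qed
next
  assume R: ?R
  show ?L
    unfolding in_closure_of
  proof (intro conjI allI impI)
    show "f \<in> topspace (product_topology (\<lambda>_. euclideanreal) I)"
      using R by (auto simp: PiE_def)
    fix T assume "f \<in> T \<and> openin (product_topology (\<lambda>_. euclideanreal) I) T"
    then obtain U where fin: "finite {i \<in> I. U i \<noteq> UNIV}"
      and op: "\<And>i. i \<in> I \<Longrightarrow> open (U i)" and fU: "f \<in> PiE I U" and sub: "PiE I U \<subseteq> T"
      unfolding openin_product_topology_alt by (auto simp flip: open_openin)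
    define J where "J = {i \<in> I. U i \<noteq> UNIV}"
    have "\<exists>e>0. ball (f i) e \<subseteq> U i" if "i \<in> I" for i
      using op[OF that] fU that by (auto simp: PiE_def open_contains_ball)
    then obtain e where e: "\<And>i. i \<in> I \<Longrightarrow> 0 < e i \<and> ball (f i) (e i) \<subseteq> U i"
      by metis
    \<comment> \<open>The 1 keeps the minimum defined when \<open>J\<close> is empty.\<close>
    define \<epsilon> where "\<epsilon> = Min (insert 1 (e ` J))"
    have "finite J" "J \<subseteq> I" using fin by (auto simp: J_def)
    moreover have "0 < \<epsilon>" using fin e by (auto simp: \<epsilon>_def J_def)
    ultimately obtain g where g: "g \<in> S" "\<And>i. i \<in> J \<Longrightarrow> \<bar>g i - f i\<bar> < \<epsilon>"
      using R[THEN conjunct2, rule_format, of J \<epsilon>] by blast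
    have "g i \<in> U i" if i: "i \<in> I" for i
    proof (cases "i \<in> J")
      case True
      have "\<epsilon> \<le> e i" using True \<open>finite J\<close> by (auto simp: \<epsilon>_def)
      then have "g i \<in> ball (f i) (e i)"
        using g(2)[OF True] by (simp add: dist_real_def abs_minus_commute)
      then show ?thesis using e[OF i] by blast
    qed (use i in \<open>auto simp: J_def\<close>)
    then have "g \<in> PiE I U" using g(1) assms by (auto simp: PiE_def)
    then show "\<exists>g. g \<in> S \<and> g \<in> T" using sub g(1) by blast
  qed
qed

section \<open>Entropy of finitely supported distributions\<close>

lemma pmf_map_eq_sum:
  assumes "finite A" "set_pmf p \<subseteq> A"
  shows "pmf (map_pmf f p) y = (\<Sum>x\<in>{x\<in>A. f x = y}. pmf p x)"
proof -
  have "pmf (map_pmf f p) y = measure p (f -` {y} \<inter> A)"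
    unfolding pmf_map using assms(2)
    by (intro measure_pmf.finite_measure_eq_AE) (auto simp: AE_measure_pmf_iff)
  also have "\<dots> = (\<Sum>x\<in>f -` {y} \<inter> A. pmf p x)"
    using assms(1) by (intro measure_measure_pmf_finite) auto
  also have "f -` {y} \<inter> A = {x\<in>A. f x = y}" by auto
  finally show ?thesis .
qed

lemma shannon_entropy_eq_sum_superset:
  assumes "finite A" "set_pmf p \<subseteq> A"
  shows "shannon_entropy p = - (\<Sum>x\<in>A. pmf p x * ln (pmf p x))"
proof -
  have "(\<Sum>x\<in>A. pmf p x * ln (pmf p x)) = (\<Sum>x\<in>set_pmf p. pmf p x * ln (pmf p x))"
    using assms by (intro sum.mono_neutral_right) (auto simp: set_pmf_iff)
  then show ?thesis
    using shannon_entropy_eq_sum[of p] finite_subset[OF assms(2,1)] by simp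
qed

text \<open>On the support of \<open>p\<close>, \<open>r x\<close> is \<open>pmf p x\<close> times
  \<open>t - 1 - ln t\<close> for the ratio \<open>t\<close> of the weights, hence nonnegative and
  zero only at \<open>t = 1\<close>; off it, \<open>r x\<close> is \<open>pmf q x\<close>. The added
  terms \<open>pmf q x - pmf p x\<close> sum to zero, as both masses on \<open>A\<close> are one.
  The equality case later detects independence.\<close>

lemma gibbs_inequality:
  assumes "finite A" "set_pmf p \<subseteq> A" "set_pmf p \<subseteq> set_pmf q" "set_pmf q \<subseteq> A"
  shows "(\<Sum>x\<in>A. pmf p x * ln (pmf q x)) \<le> (\<Sum>x\<in>A. pmf p x * ln (pmf p x))"
    and "(\<Sum>x\<in>A. pmf p x * ln (pmf q x)) = (\<Sum>x\<in>A. pmf p x * ln (pmf p x)) \<Longrightarrow> p = q"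
proof -
  define r where "r x = pmf q x - pmf p x - (pmf p x * ln (pmf q x) - pmf p x * ln (pmf p x))" for x
  have r: "0 \<le> r x \<and> (r x = 0 \<longrightarrow> pmf p x = pmf q x)" for x
  proof (cases "x \<in> set_pmf p")
    case True
    then have p: "0 < pmf p x" and q: "0 < pmf q x"
      using assms(3) by (auto simp: pmf_positive_iff)
    have *: "r x = pmf p x * (pmf q x / pmf p x - 1 - ln (pmf q x / pmf p x))"
      using p q by (simp add: r_def ln_div field_simps)
    have "ln (pmf q x / pmf p x) \<le> pmf q x / pmf p x - 1"
      using p q by (intro ln_le_minus_one) simp
    moreover have "pmf q x / pmf p x = 1" if "ln (pmf q x / pmf p x) = pmf q x / pmf p x - 1"
      using p q that by (intro ln_eq_minus_one) auto
    ultimately have "0 \<le> pmf q x / pmf p x - 1 - ln (pmf q x / pmf p x)"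
      and "pmf q x / pmf p x - 1 - ln (pmf q x / pmf p x) = 0 \<longrightarrow> pmf p x = pmf q x"
      using p by (auto simp del: ln_div)
    then show ?thesis using p unfolding * by (simp del: ln_div)
  next
    case False
    then have "pmf p x = 0" by (simp add: set_pmf_iff)
    then show ?thesis by (auto simp: r_def)
  qed
  have sum_r: "(\<Sum>x\<in>A. r x) = (\<Sum>x\<in>A. pmf p x * ln (pmf p x)) - (\<Sum>x\<in>A. pmf p x * ln (pmf q x))"
    using assms by (simp add: r_def sum_subtractf sum_pmf_eq_1)
  show "(\<Sum>x\<in>A. pmf p x * ln (pmf q x)) \<le> (\<Sum>x\<in>A. pmf p x * ln (pmf p x))"
    using sum_nonneg[of A r] r sum_r by simp
  assume "(\<Sum>x\<in>A. pmf p x * ln (pmf q x)) = (\<Sum>x\<in>A. pmf p x * ln (pmf p x))"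
  then have "sum r A = 0" using sum_r by linarith
  then have "\<forall>x\<in>A. r x = 0"
    using r assms(1) by (simp add: sum_nonneg_eq_0_iff)
  then have "pmf p x = pmf q x" for x
  proof (cases "x \<in> A")
    case False
    then have "pmf p x = 0" "pmf q x = 0" using assms by (auto simp: set_pmf_iff)
    then show ?thesis by simp
  qed (use r in blast)
  then show "p = q" by (rule pmf_eqI)
qed

text \<open>This is the Gibbs inequality against the uniform distribution on
  \<open>A\<close>.\<close>

lemma shannon_entropy_le_ln_card:
  assumes "finite A" "set_pmf p \<subseteq> A"
  shows "shannon_entropy p \<le> ln (real (card A))"
proof -
  have "A \<noteq> {}" using assms(2) set_pmf_not_empty[of p] by auto
  have "(\<Sum>x\<in>A. pmf p x * ln (pmf (pmf_of_set A) x)) \<le> (\<Sum>x\<in>A. pmf p x * ln (pmf p x))"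
    using assms \<open>A \<noteq> {}\<close> by (intro gibbs_inequality) auto
  moreover have "(\<Sum>x\<in>A. pmf p x * ln (pmf (pmf_of_set A) x)) = - ln (real (card A))"
  proof -
    have "(\<Sum>x\<in>A. pmf p x * ln (pmf (pmf_of_set A) x)) = (\<Sum>x\<in>A. pmf p x * - ln (real (card A)))"
      using assms \<open>A \<noteq> {}\<close> by (intro sum.cong) (auto simp: ln_div card_gt_0_iff)
    also have "\<dots> = - ln (real (card A))"
      unfolding sum_distrib_right[symmetric] using assms by (simp add: sum_pmf_eq_1)
    finally show ?thesis .
  qed
  ultimately show ?thesis
    using shannon_entropy_eq_sum_superset[OF assms] by simp
qed

lemma shannon_entropy_pmf_of_set:
  assumes "finite A" "A \<noteq> {}"
  shows "shannon_entropy (pmf_of_set A) = ln (real (card A))"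
  using assms by (subst shannon_entropy_eq_sum_superset[of A]) (auto simp: ln_div card_gt_0_iff)

lemma shannon_entropy_map_inj:
  assumes "finite (set_pmf p)" "inj_on f (set_pmf p)"
  shows "shannon_entropy (map_pmf f p) = shannon_entropy p"
  using assms by (simp add: shannon_entropy_eq_sum sum.reindex pmf_map_inj)

section \<open>Continuity of entropy and compactness of the distributions on a finite set\<close>

text \<open>The function \<open>x * ln x\<close> is continuous on the closed half-line: at 0 the
  product is 0 whatever value \<open>ln 0\<close> has, and this agrees with the right-hand limit.
  Weights that tend to zero are thereby covered.\<close>

lemma tendsto_mult_ln_self:
  fixes f :: "nat \<Rightarrow> real"
  assumes "f \<longlonglongrightarrow> a" "\<And>n. 0 \<le> f n"
  shows "(\<lambda>n. f n * ln (f n)) \<longlonglongrightarrow> a * ln a"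
proof (cases "a = 0")
  case False
  then show ?thesis using assms(1) by (intro tendsto_intros) auto
next
  case True
  have "((\<lambda>x::real. x * ln x) \<longlongrightarrow> 0) (at_right 0)" by real_asymp
  then have "((\<lambda>x::real. x * ln x) \<longlongrightarrow> 0 * ln 0) (at 0 within {0..})"
    by (simp add: at_within_Ici_at_right)
  then have "continuous (at 0 within {0..}) (\<lambda>x::real. x * ln x)"
    by (simp add: continuous_within)
  then show ?thesis
    using continuous_within_tendsto_compose'[of 0 "{0..}" "\<lambda>x. x * ln x" f] assms True by simp
qed

lemma tendsto_shannon_entropy:
  assumes "finite A" "\<And>j. set_pmf (p j) \<subseteq> A" "set_pmf q \<subseteq> A"
    and "\<And>x. x \<in> A \<Longrightarrow> (\<lambda>j::nat. pmf (p j) x) \<longlonglongrightarrow> pmf q x"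
  shows "(\<lambda>j. shannon_entropy (p j)) \<longlonglongrightarrow> shannon_entropy q"
  using assms
  by (simp only: shannon_entropy_eq_sum_superset[of A])
     (intro tendsto_minus tendsto_sum tendsto_mult_ln_self, auto)

lemma tendsto_pmf_map:
  assumes "finite A" "\<And>j. set_pmf (p j) \<subseteq> A" "set_pmf q \<subseteq> A"
    and "\<And>x. x \<in> A \<Longrightarrow> (\<lambda>j::nat. pmf (p j) x) \<longlonglongrightarrow> pmf q x"
  shows "(\<lambda>j. pmf (map_pmf f (p j)) y) \<longlonglongrightarrow> pmf (map_pmf f q) y"
  using assms
  by (simp only: pmf_map_eq_sum[of A]) (intro tendsto_sum, auto)

lemma pmf_with_given_values:
  assumes "finite A" "\<And>x. x \<in> A \<Longrightarrow> 0 \<le> f x" "(\<Sum>x\<in>A. f x) = (1::real)"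
  obtains q where "set_pmf q \<subseteq> A" "\<And>x. x \<in> A \<Longrightarrow> pmf q x = f x"
proof -
  define g where "g x = (if x \<in> A then f x else 0)" for x
  have nn: "0 \<le> g x" for x using assms by (simp add: g_def)
  have "(\<integral>\<^sup>+ x. ennreal (g x) \<partial>count_space UNIV) = (\<integral>\<^sup>+ x. ennreal (f x) \<partial>count_space A)"
    by (subst nn_integral_count_space_indicator) (auto intro!: nn_integral_cong simp: g_def)
  also have "\<dots> = 1"
    using assms by (simp add: nn_integral_count_space_finite sum_ennreal)
  finally have one: "(\<integral>\<^sup>+ x. ennreal (g x) \<partial>count_space UNIV) = 1" .
  show thesis
  proof (rule that)
    show "set_pmf (embed_pmf g) \<subseteq> A"
      unfolding set_embed_pmf[OF nn one] by (auto simp: g_def)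
    show "pmf (embed_pmf g) x = f x" if "x \<in> A" for x
      unfolding pmf_embed_pmf[OF nn one] using that by (simp add: g_def)
  qed
qed

text \<open>Bolzano-Weierstrass one coordinate at a time: each new point of \<open>A\<close> refines
  the subsequence found so far, which preserves the limits at the earlier points.\<close>

lemma convergent_subsequence_on_finite_set:
  fixes f :: "nat \<Rightarrow> 'a \<Rightarrow> real"
  assumes "finite A" "\<And>j x. x \<in> A \<Longrightarrow> f j x \<in> {0..1}"
  obtains s l where "strict_mono (s :: nat \<Rightarrow> nat)" "\<And>x. x \<in> A \<Longrightarrow> (\<lambda>j. f (s j) x) \<longlonglongrightarrow> l x"
proof -
  have "\<exists>s l. strict_mono (s :: nat \<Rightarrow> nat) \<and> (\<forall>x\<in>A. (\<lambda>j. f (s j) x) \<longlonglongrightarrow> l x)"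
    using assms
  proof (induction A rule: finite_induct)
    case empty
    show ?case by (rule exI[of _ id]) (simp add: strict_mono_def)
  next
    case (insert a A)
    then obtain s l where s: "strict_mono s" "\<And>x. x \<in> A \<Longrightarrow> (\<lambda>j. f (s j) x) \<longlonglongrightarrow> l x"
      by blast
    have "seq_compact {0..1::real}" by (simp add: compact_imp_seq_compact)
    moreover have "\<forall>j. f (s j) a \<in> {0..1}" using insert.prems by blast
    ultimately obtain l' r where r: "strict_mono r" "((\<lambda>j. f (s j) a) \<circ> r) \<longlonglongrightarrow> l'"
      unfolding seq_compact_def by meson
    have "(\<lambda>j. f ((s \<circ> r) j) x) \<longlonglongrightarrow> (l(a := l')) x" if "x \<in> insert a A" for x
    proof (cases "x = a")
      case True
      then show ?thesis using r(2) by (simp add: o_def)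
    next
      case False
      then show ?thesis
        using LIMSEQ_subseq_LIMSEQ[OF s(2) r(1)] that by (simp add: o_def)
    qed
    then show ?case using strict_mono_o[OF s(1) r(1)] by blast
  qed
  then show thesis using that by blast
qed

text \<open>No mass escapes, because the total mass is a finite sum and passes to the limit; the
  limits of the weights are therefore again the weights of a distribution.\<close>

lemma pmf_convergent_subsequence:
  assumes "finite A" "\<And>j. set_pmf (p j) \<subseteq> A"
  obtains s q where "strict_mono (s :: nat \<Rightarrow> nat)" "set_pmf q \<subseteq> A"
    "\<And>x. x \<in> A \<Longrightarrow> (\<lambda>j. pmf (p (s j)) x) \<longlonglongrightarrow> pmf q x"
proof -
  obtain s l where s: "strict_mono (s :: nat \<Rightarrow> nat)"
    and l: "\<And>x. x \<in> A \<Longrightarrow> (\<lambda>j. pmf (p (s j)) x) \<longlonglongrightarrow> l x"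
    using convergent_subsequence_on_finite_set[of A "\<lambda>j. pmf (p j)"] assms(1)
    by (auto simp: pmf_le_1)
  have "0 \<le> l x" if "x \<in> A" for x
    using l[OF that] by (rule LIMSEQ_le_const) auto
  moreover have "(\<Sum>x\<in>A. l x) = 1"
  proof (rule LIMSEQ_unique)
    show "(\<lambda>j. \<Sum>x\<in>A. pmf (p (s j)) x) \<longlonglongrightarrow> (\<Sum>x\<in>A. l x)" by (intro tendsto_sum l)
    show "(\<lambda>j. \<Sum>x\<in>A. pmf (p (s j)) x) \<longlonglongrightarrow> 1" using assms by (simp add: sum_pmf_eq_1)
  qed
  ultimately obtain q where "set_pmf q \<subseteq> A" "\<And>x. x \<in> A \<Longrightarrow> pmf q x = l x"
    using pmf_with_given_values[of A l] assms(1) by blast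
  then show thesis using that[of s q] s l by auto
qed

section \<open>Vertex assignments and independence\<close>

text \<open>One function on the disjoint sum of the classes replaces the pair of maps used in
  \<open>Hom\<close>, so that homomorphisms and the outcomes of members of \<open>Q\<close> become
  objects of the same type.\<close>

definition assignments :: "bigraph \<Rightarrow> nat set \<Rightarrow> nat set \<Rightarrow> (nat + nat \<Rightarrow> nat) set" where
  "assignments H A B = (\<Pi>\<^sub>E x\<in>V1 H <+> V2 H. case x of Inl _ \<Rightarrow> A | Inr _ \<Rightarrow> B)"

definition edge_value :: "nat \<times> nat \<Rightarrow> (nat + nat \<Rightarrow> nat) \<Rightarrow> nat \<times> nat" where
  "edge_value e \<omega> = (\<omega> (Inl (fst e)), \<omega> (Inr (snd e)))"

definition homs :: "bigraph \<Rightarrow> bigraph \<Rightarrow> (nat + nat \<Rightarrow> nat) set" where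
  "homs H G = {\<omega> \<in> assignments H (V1 G) (V2 G). \<forall>e\<in>edges H. edge_value e \<omega> \<in> edges G}"

lemma assignments_iff:
  "\<omega> \<in> assignments H A B \<longleftrightarrow> (\<forall>v\<in>V1 H. \<omega> (Inl v) \<in> A) \<and> (\<forall>w\<in>V2 H. \<omega> (Inr w) \<in> B) \<and>
     \<omega> \<in> extensional (V1 H <+> V2 H)"
  by (auto simp: assignments_def PiE_iff Plus_def ball_Un)

lemma homs_iff:
  "\<omega> \<in> homs H G \<longleftrightarrow> \<omega> \<in> assignments H (V1 G) (V2 G) \<and>
     (\<forall>v w. (v, w) \<in> edges H \<longrightarrow> (\<omega> (Inl v), \<omega> (Inr w)) \<in> edges G)"
  by (auto simp: homs_def edge_value_def)

lemma assignments_eqI: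
  assumes "\<omega> \<in> assignments H A B" "\<omega>' \<in> assignments H A' B'"
    and "\<And>v. v \<in> V1 H \<Longrightarrow> \<omega> (Inl v) = \<omega>' (Inl v)" "\<And>w. w \<in> V2 H \<Longrightarrow> \<omega> (Inr w) = \<omega>' (Inr w)"
  shows "\<omega> = \<omega>'"
  by (rule extensionalityI[of _ "V1 H <+> V2 H"]) (use assms in \<open>auto simp: assignments_iff\<close>)

lemma finite_assignments:
  assumes "finite (V1 H)" "finite (V2 H)" "finite A" "finite B"
  shows "finite (assignments H A B)"
  unfolding assignments_def using assms by (intro finite_PiE) (auto split: sum.split)

text \<open>Restricting an assignment to the two classes is a bijection onto \<open>Hom H G\<close>.
  The condition on the edges puts their endpoints where the restrictions keep the values.\<close>

lemma card_homs: "card (homs H G) = card (Hom H G)" if "edges H \<subseteq> V1 H \<times> V2 H"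
proof -
  let ?split = "\<lambda>\<omega>. (\<lambda>v\<in>V1 H. \<omega> (Inl v), \<lambda>w\<in>V2 H. \<omega> (Inr w))"
  let ?join = "\<lambda>(f, g). \<lambda>x\<in>V1 H <+> V2 H. case x of Inl v \<Rightarrow> f v | Inr w \<Rightarrow> g w"
  have "bij_betw ?split (homs H G) (Hom H G)"
  proof (rule bij_betw_byWitness[where f' = ?join])
    show "\<forall>\<omega>\<in>homs H G. ?join (?split \<omega>) = \<omega>"
      by (auto simp: homs_iff assignments_iff extensional_def fun_eq_iff split: sum.split)
    show "\<forall>fg\<in>Hom H G. ?split (?join fg) = fg"
      by (auto simp: Hom_def PiE_def extensional_def fun_eq_iff)
    show "?split ` homs H G \<subseteq> Hom H G"
    proof (intro image_subsetI)
      fix \<omega> assume "\<omega> \<in> homs H G"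
      moreover have "v \<in> V1 H \<and> w \<in> V2 H" if "(v, w) \<in> edges H" for v w
        using that \<open>edges H \<subseteq> V1 H \<times> V2 H\<close> by blast
      ultimately show "?split \<omega> \<in> Hom H G"
        by (auto simp: homs_iff Hom_def assignments_iff)
    qed
    show "?join ` Hom H G \<subseteq> homs H G"
    proof (intro image_subsetI)
      fix fg assume "fg \<in> Hom H G"
      then obtain f g where fg: "fg = (f, g)" "(f, g) \<in> Hom H G" by (cases fg) auto
      moreover have "v \<in> V1 H \<and> w \<in> V2 H" if "(v, w) \<in> edges H" for v w
        using that \<open>edges H \<subseteq> V1 H \<times> V2 H\<close> by blast
      ultimately show "?join fg \<in> homs H G"
        by (auto simp: homs_iff Hom_def assignments_iff PiE_iff)
    qed
  qed
  then show ?thesis by (rule bij_betw_same_card)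
qed

section \<open>Couplings along the edges, independence and mutual information\<close>

lemma Q_iff:
  "q \<in> Q H X \<longleftrightarrow> set_pmf q \<subseteq> assignments H (F1 X) (F2 X) \<and>
     (\<forall>e\<in>edges H. map_pmf (edge_value e) q = law X)"
  by (auto simp: Q_def assignments_def edge_value_def [abs_def])

lemma M2_D:
  assumes "H \<in> M2"
  shows "finite (V1 H)" "finite (V2 H)" "edges H \<subseteq> V1 H \<times> V2 H" "edges H \<noteq> {}" "finite (edges H)"
    and "\<And>v. v \<in> V1 H \<Longrightarrow> \<exists>w. (v, w) \<in> edges H" "\<And>w. w \<in> V2 H \<Longrightarrow> \<exists>v. (v, w) \<in> edges H"
  using assms
  by (auto simp: M2_def bigraphs0_def bigraphs_def no_isolated_vertices_def
           intro: finite_subset[of "edges H" "V1 H \<times> V2 H"])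

lemma P1_in_M2: "P1 \<in> M2"
  by (auto simp: M2_def P1_def bigraphs0_def bigraphs_def no_isolated_vertices_def)

text \<open>Independence compares the joint distribution with the product measure of the marginals.
  On a countable discrete space measures are determined by singletons, which identifies this product
  with \<open>pair_pmf\<close>.\<close>

lemma independent_iff_pair_pmf: "independent X \<longleftrightarrow> law X = pair_pmf (law1 X) (law2 X)"
proof -
  have sets: "sets (measure_pmf (law1 X) \<Otimes>\<^sub>M measure_pmf (law2 X)) = Pow UNIV"
    by (subst sets_pair_countable[of UNIV UNIV]) auto
  have pair: "measure_pmf (law1 X) \<Otimes>\<^sub>M measure_pmf (law2 X) = measure_pmf (pair_pmf (law1 X) (law2 X))"
  proof (rule measure_eqI_countable[of _ UNIV])
    fix z :: "nat \<times> nat"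
    have "emeasure (measure_pmf (law1 X) \<Otimes>\<^sub>M measure_pmf (law2 X)) ({fst z} \<times> {snd z}) =
      emeasure (measure_pmf (law1 X)) {fst z} * emeasure (measure_pmf (law2 X)) {snd z}"
      by (intro measure_pmf.emeasure_pair_measure_Times) auto
    then show "emeasure (measure_pmf (law1 X) \<Otimes>\<^sub>M measure_pmf (law2 X)) {z} =
       emeasure (measure_pmf (pair_pmf (law1 X) (law2 X))) {z}"
      by (cases z) (simp add: emeasure_pmf_single pmf_pair ennreal_mult del: pmf_map)
  qed (use sets in auto)
  have "distr (measure_pmf (law X)) (count_space UNIV \<Otimes>\<^sub>M count_space UNIV) (\<lambda>x. (fst x, snd x)) =
    measure_pmf (law X)"
    using map_pmf_rep_eq[of "\<lambda>x. x" "law X"] by (simp add: pair_measure_countable map_pmf_ident)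
  then show ?thesis
    unfolding independent_def prob_space.indep_var_distribution_eq[OF prob_space_measure_pmf]
    by (simp add: pair map_pmf_rep_eq[symmetric] measure_pmf_inject eq_commute)
qed

text \<open>The logarithm of a product weight splits wherever the joint weight is positive, and the
  other pairs contribute zero; summing out one coordinate then leaves the marginal entropies. With
  the Gibbs inequality this makes \<open>dstar P1 X\<close> a relative entropy.\<close>

lemma shannon_entropy_pair_law:
  assumes "finite (F1 X)" "finite (F2 X)" "set_pmf (law X) \<subseteq> F1 X \<times> F2 X"
  shows "(\<Sum>z\<in>F1 X \<times> F2 X. pmf (law X) z * ln (pmf (pair_pmf (law1 X) (law2 X)) z)) =
    - shannon_entropy (law1 X) - shannon_entropy (law2 X)"
proof -
  let ?p = "law X"
  have p1: "pmf (law1 X) a = (\<Sum>b\<in>F2 X. pmf ?p (a, b))" if "a \<in> F1 X" for a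
  proof -
    have "{z \<in> F1 X \<times> F2 X. fst z = a} = Pair a ` F2 X" using that by auto
    then show ?thesis
      using assms by (subst pmf_map_eq_sum[of "F1 X \<times> F2 X"]) (auto simp: sum.reindex inj_on_def)
  qed
  have p2: "pmf (law2 X) b = (\<Sum>a\<in>F1 X. pmf ?p (a, b))" if "b \<in> F2 X" for b
  proof -
    have "{z \<in> F1 X \<times> F2 X. snd z = b} = (\<lambda>a. (a, b)) ` F1 X" using that by auto
    then show ?thesis
      using assms by (subst pmf_map_eq_sum[of "F1 X \<times> F2 X"]) (auto simp: sum.reindex inj_on_def)
  qed
  have split: "pmf ?p (a, b) * ln (pmf (pair_pmf (law1 X) (law2 X)) (a, b)) =
    pmf ?p (a, b) * ln (pmf (law1 X) a) + pmf ?p (a, b) * ln (pmf (law2 X) b)" for a b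
  proof (cases "(a, b) \<in> set_pmf ?p")
    case True
    then have "a \<in> set_pmf (law1 X)" "b \<in> set_pmf (law2 X)" by force+
    then have "0 < pmf (law1 X) a" "0 < pmf (law2 X) b" by (auto simp only: pmf_positive_iff)
    then show ?thesis by (simp add: pmf_pair ln_mult distrib_left del: pmf_map)
  next
    case False
    then show ?thesis by (simp add: set_pmf_iff)
  qed
  have "(\<Sum>z\<in>F1 X \<times> F2 X. pmf ?p z * ln (pmf (pair_pmf (law1 X) (law2 X)) z)) =
    (\<Sum>a\<in>F1 X. \<Sum>b\<in>F2 X. pmf ?p (a, b) * ln (pmf (law1 X) a)) +
    (\<Sum>a\<in>F1 X. \<Sum>b\<in>F2 X. pmf ?p (a, b) * ln (pmf (law2 X) b))"
    unfolding sum.cartesian_product' sum.distrib[symmetric] using split by simp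
  also have "(\<Sum>a\<in>F1 X. \<Sum>b\<in>F2 X. pmf ?p (a, b) * ln (pmf (law1 X) a)) = - shannon_entropy (law1 X)"
    using assms by (subst shannon_entropy_eq_sum_superset[of "F1 X"])
      (auto simp: p1 sum_distrib_right simp del: pmf_map)
  also have "(\<Sum>a\<in>F1 X. \<Sum>b\<in>F2 X. pmf ?p (a, b) * ln (pmf (law2 X) b)) = - shannon_entropy (law2 X)"
    using assms by (subst sum.swap, subst shannon_entropy_eq_sum_superset[of "F2 X"])
      (auto simp: p2 sum_distrib_right simp del: pmf_map)
  finally show ?thesis by simp
qed

lemma bdd_above_entropy_Q:
  assumes "H \<in> M2" "X \<in> finite_joint_dists"
  shows "bdd_above (shannon_entropy ` Q H X)"
  using shannon_entropy_le_ln_card[OF finite_assignments] assms M2_D[OF assms(1)]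
  by (intro bdd_aboveI2[of _ _ "ln (real (card (assignments H (F1 X) (F2 X))))"])
     (auto simp: Q_iff finite_joint_dists_def)

text \<open>An assignment on the single edge carries the same information as the pair of its values,
  so reading off that pair is injective and all members of \<open>Q P1 X\<close> have the entropy of
  \<open>law X\<close>. The map \<open>\<phi>\<close> provides one member, so the supremum is over a
  singleton.\<close>

lemma m_P1:
  assumes "X \<in> finite_joint_dists"
  shows "m P1 X = shannon_entropy (law X)"
proof -
  have fin: "finite (set_pmf q)" if "q \<in> Q P1 X" for q
    using that assms finite_assignments[of P1 "F1 X" "F2 X"] finite_subset
    by (auto simp: Q_iff P1_def finite_joint_dists_def)
  have *: "shannon_entropy q = shannon_entropy (law X)" if q: "q \<in> Q P1 X" for q
  proof -
    have "inj_on (edge_value (0, 0)) (set_pmf q)"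
      using q by (auto intro!: inj_onI assignments_eqI[of _ P1 "F1 X" "F2 X" _ "F1 X" "F2 X"]
          simp: Q_iff P1_def edge_value_def)
    moreover have "map_pmf (edge_value (0, 0)) q = law X" using q by (auto simp: Q_iff P1_def)
    ultimately show ?thesis using shannon_entropy_map_inj[OF fin[OF q]] by metis
  qed
  define \<phi> where "\<phi> z = (\<lambda>x\<in>V1 P1 <+> V2 P1. case x of Inl _ \<Rightarrow> fst z | Inr _ \<Rightarrow> snd z)"
    for z :: "nat \<times> nat"
  have "map_pmf \<phi> (law X) \<in> Q P1 X"
  proof -
    have "edge_value (0, 0) \<circ> \<phi> = id"
      by (auto simp: fun_eq_iff edge_value_def \<phi>_def P1_def)
    then have "map_pmf (edge_value (0, 0)) (map_pmf \<phi> (law X)) = law X"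
      by (simp add: pmf.map_comp)
    then show ?thesis using assms
      by (auto simp: Q_iff \<phi>_def P1_def assignments_iff finite_joint_dists_def)
  qed
  then have "shannon_entropy ` Q P1 X = {shannon_entropy (law X)}"
    using * by force
  then show ?thesis by (simp add: m_def)
qed

text \<open>\<open>dstar P1 X\<close> is the mutual information, the relative entropy of the joint
  law to the product of its marginals; its vanishing is the equality case of Gibbs. Thus
  \<open>hstar\<close> never divides by zero in the dependent case.\<close>

lemma dstar_P1_eq_0_imp_independent:
  assumes X: "X \<in> finite_joint_dists" and "dstar P1 X = 0"
  shows "independent X"
proof -
  let ?F = "F1 X \<times> F2 X"
  have fin: "finite (F1 X)" "finite (F2 X)" "set_pmf (law X) \<subseteq> ?F"
    using X by (auto simp: finite_joint_dists_def)
  have "card (V1 P1) = 1" "card (V2 P1) = 1" by (auto simp: P1_def)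
  then have "shannon_entropy (law X) = shannon_entropy (law1 X) + shannon_entropy (law2 X)"
    using assms(2) by (simp add: dstar_def m_P1[OF X])
  then have "(\<Sum>z\<in>?F. pmf (law X) z * ln (pmf (pair_pmf (law1 X) (law2 X)) z)) =
    (\<Sum>z\<in>?F. pmf (law X) z * ln (pmf (law X) z))"
    using shannon_entropy_pair_law[OF fin] shannon_entropy_eq_sum_superset[of ?F "law X"] fin by simp
  moreover have "set_pmf (law X) \<subseteq> set_pmf (pair_pmf (law1 X) (law2 X))" by force
  ultimately show ?thesis
    unfolding independent_iff_pair_pmf using fin by (intro gibbs_inequality(2)[of ?F]) auto
qed

text \<open>An injective map that preserves \<open>p\<close> and sends \<open>a\<close> to
  \<open>x\<close> has \<open>a\<close> as the only preimage of \<open>x\<close> in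
  \<open>A\<close>, so both points have the same weight.\<close>

lemma pmf_of_set_if_transitive:
  assumes A: "finite A" "A \<noteq> {}" "set_pmf p \<subseteq> A"
    and trans: "\<And>x y. x \<in> A \<Longrightarrow> y \<in> A \<Longrightarrow> \<exists>f. inj_on f A \<and> map_pmf f p = p \<and> f x = y"
  shows "p = pmf_of_set A"
proof -
  obtain a where a: "a \<in> A" using A by blast
  have const: "pmf p x = pmf p a" if x: "x \<in> A" for x
  proof -
    obtain f where f: "inj_on f A" "map_pmf f p = p" "f a = x" using trans[OF a x] by blast
    have "{z \<in> A. f z = x} = {a}" using f a by (auto dest: inj_onD)
    then have "pmf (map_pmf f p) x = pmf p a" using A by (simp add: pmf_map_eq_sum[of A])
    then show ?thesis by (simp add: f)
  qed
  have "(\<Sum>x\<in>A. pmf p x) = real (card A) * pmf p a" using const by simp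
  then have "pmf p a = 1 / real (card A)"
    using A by (simp add: sum_pmf_eq_1 field_simps)
  then have "pmf p x = pmf (pmf_of_set A) x" for x
    using A const[of x] by (cases "x \<in> A") (auto simp: set_pmf_iff)
  then show ?thesis by (rule pmf_eqI)
qed

section \<open>Transitive graphs as joint distributions\<close>

definition edge_law :: "bigraph \<Rightarrow> joint_dist" where
  "edge_law G = \<lparr>F1 = V1 G, F2 = V2 G, law = pmf_of_set (edges G)\<rparr>"

lemma bigraphs0_D:
  assumes "G \<in> bigraphs0"
  shows "finite (V1 G)" "finite (V2 G)" "edges G \<subseteq> V1 G \<times> V2 G" "edges G \<noteq> {}" "finite (edges G)"
    "V1 G \<noteq> {}" "V2 G \<noteq> {}"
  using assms
  by (auto simp: bigraphs0_def bigraphs_def intro: finite_subset[of "edges G" "V1 G \<times> V2 G"])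

text \<open>All of \<open>H\<close> can be folded onto one edge of \<open>G\<close>.\<close>

lemma homs_nonempty:
  assumes "G \<in> bigraphs0" "edges H \<subseteq> V1 H \<times> V2 H"
  shows "homs H G \<noteq> {}"
proof -
  obtain a b where ab: "(a, b) \<in> edges G" using bigraphs0_D(4)[OF assms(1)] by auto
  then have "a \<in> V1 G" "b \<in> V2 G" using bigraphs0_D(3)[OF assms(1)] by auto
  then have "(\<lambda>x\<in>V1 H <+> V2 H. case x of Inl _ \<Rightarrow> a | Inr _ \<Rightarrow> b) \<in> homs H G"
    using ab assms(2) by (auto simp: homs_iff assignments_iff)
  then show ?thesis by blast
qed

lemma finite_homs:
  assumes "finite (V1 H)" "finite (V2 H)" "finite (V1 G)" "finite (V2 G)"
  shows "finite (homs H G)"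
  using finite_assignments[OF assms] by (auto simp: homs_def)

lemma edge_law_in_finite_joint_dists:
  assumes "G \<in> bigraphs0"
  shows "edge_law G \<in> finite_joint_dists"
  using bigraphs0_D[OF assms] by (simp add: edge_law_def finite_joint_dists_def)

lemma map_Aut_edges:
  assumes G: "G \<in> bigraphs0" and fg: "(f, g) \<in> Aut G"
  shows "map_pmf (map_prod f g) (pmf_of_set (edges G)) = pmf_of_set (edges G)"
proof -
  note G' = bigraphs0_D[OF G]
  have "inj_on (map_prod f g) (V1 G \<times> V2 G)"
    using fg by (auto simp: Aut_def bij_betw_def inj_on_def)
  then have inj: "inj_on (map_prod f g) (edges G)" using G'(3) by (rule inj_on_subset)
  moreover have "map_prod f g ` edges G \<subseteq> edges G"
    using fg G'(3) by (auto simp: Aut_def)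
  ultimately have "map_prod f g ` edges G = edges G"
    using G'(5) by (intro endo_inj_surj)
  then show ?thesis using inj G' by (simp add: map_pmf_of_set_inj)
qed

text \<open>Automorphisms preserve the uniform law on the edges, hence also its marginal;
  transitivity on the class then forces that marginal to be uniform.\<close>

lemma law1_edge_law:
  assumes G: "G \<in> bigraphs0" and "edge_vertex_transitive G"
  shows "law1 (edge_law G) = pmf_of_set (V1 G)"
proof (rule pmf_of_set_if_transitive)
  note G' = bigraphs0_D[OF G]
  show "finite (V1 G)" "V1 G \<noteq> {}" using G' by auto
  show "set_pmf (law1 (edge_law G)) \<subseteq> V1 G" using G' by (auto simp: edge_law_def)
  fix x y assume "x \<in> V1 G" "y \<in> V1 G"
  then obtain f g where fg: "(f, g) \<in> Aut G" "f x = y"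
    using assms(2) unfolding edge_vertex_transitive_def by blast
  have "map_pmf f (law1 (edge_law G)) = map_pmf fst (map_pmf (map_prod f g) (law (edge_law G)))"
    by (simp add: pmf.map_comp o_def)
  also have "\<dots> = law1 (edge_law G)"
    using map_Aut_edges[OF G fg(1)] by (simp add: edge_law_def)
  finally show "\<exists>f. inj_on f (V1 G) \<and> map_pmf f (law1 (edge_law G)) = law1 (edge_law G) \<and> f x = y"
    using fg by (auto simp: Aut_def bij_betw_def)
qed

lemma law2_edge_law:
  assumes G: "G \<in> bigraphs0" and "edge_vertex_transitive G"
  shows "law2 (edge_law G) = pmf_of_set (V2 G)"
proof (rule pmf_of_set_if_transitive)
  note G' = bigraphs0_D[OF G]
  show "finite (V2 G)" "V2 G \<noteq> {}" using G' by auto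
  show "set_pmf (law2 (edge_law G)) \<subseteq> V2 G" using G' by (auto simp: edge_law_def)
  fix x y assume "x \<in> V2 G" "y \<in> V2 G"
  then obtain f g where fg: "(f, g) \<in> Aut G" "g x = y"
    using assms(2) unfolding edge_vertex_transitive_def by blast
  have "map_pmf g (law2 (edge_law G)) = map_pmf snd (map_pmf (map_prod f g) (law (edge_law G)))"
    by (simp add: pmf.map_comp o_def)
  also have "\<dots> = law2 (edge_law G)"
    using map_Aut_edges[OF G fg(1)] by (simp add: edge_law_def)
  finally show "\<exists>f. inj_on f (V2 G) \<and> map_pmf f (law2 (edge_law G)) = law2 (edge_law G) \<and> f x = y"
    using fg by (auto simp: Aut_def bij_betw_def)
qed

text \<open>Composition with an automorphism of \<open>G\<close> permutes the homomorphisms, so the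
  image of the edge \<open>e\<close> under a uniformly random homomorphism has an
  automorphism-invariant law. Edge transitivity makes this law uniform.\<close>

lemma map_edge_value_uniform_homs:
  assumes G: "G \<in> bigraphs0" and trans: "edge_vertex_transitive G" and H: "H \<in> M2"
    and e: "e \<in> edges H"
  shows "map_pmf (edge_value e) (pmf_of_set (homs H G)) = pmf_of_set (edges G)"
proof (rule pmf_of_set_if_transitive)
  note G' = bigraphs0_D[OF G] and H' = M2_D[OF H]
  have fin: "finite (homs H G)" and ne: "homs H G \<noteq> {}"
    using finite_homs homs_nonempty[OF G] G' H' by auto
  show "finite (edges G)" "edges G \<noteq> {}" using G' by auto
  show "set_pmf (map_pmf (edge_value e) (pmf_of_set (homs H G))) \<subseteq> edges G"
    using fin ne e by (auto simp: homs_def)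
  fix x y assume xy: "x \<in> edges G" "y \<in> edges G"
  obtain v w v' w' where x: "x = (v, w)" and y: "y = (v', w')" by (cases x, cases y)
  have "\<forall>(v', w')\<in>edges G. \<exists>(f, g)\<in>Aut G. f v = v' \<and> g w = w'"
    using bspec[OF conjunct1[OF trans[unfolded edge_vertex_transitive_def]] xy(1)] x by simp
  from bspec[OF this xy(2)] obtain f g where fg: "(f, g) \<in> Aut G" "map_prod f g x = y"
    by (auto simp: x y)
  have Aut: "inj_on f (V1 G)" "inj_on g (V2 G)" "f ` V1 G = V1 G" "g ` V2 G = V2 G"
    "\<And>v w. (v, w) \<in> edges G \<Longrightarrow> (f v, g w) \<in> edges G"
    using fg(1) G'(3) by (auto simp: Aut_def bij_betw_def)
  \<comment> \<open>\<open>\<Psi>\<close> composes an assignment with the automorphism,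
    \<open>f\<close> acting on values at \<open>Inl\<close> and \<open>g\<close> on values at
    \<open>Inr\<close>.\<close>
  define \<Psi> where "\<Psi> \<omega> = (\<lambda>x\<in>V1 H <+> V2 H. case x of Inl v \<Rightarrow> f (\<omega> x) | Inr w \<Rightarrow> g (\<omega> x))"
    for \<omega> :: "nat + nat \<Rightarrow> nat"
  have \<Psi>_simps: "v \<in> V1 H \<Longrightarrow> \<Psi> \<omega> (Inl v) = f (\<omega> (Inl v))" "w \<in> V2 H \<Longrightarrow> \<Psi> \<omega> (Inr w) = g (\<omega> (Inr w))"
    for v w \<omega> by (auto simp: \<Psi>_def)
  have mem: "v \<in> V1 H" "w \<in> V2 H" if "(v, w) \<in> edges H" for v w using H'(3) that by auto
  have "inj_on \<Psi> (homs H G)"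
  proof (rule inj_onI)
    fix \<omega> \<omega>' assume h: "\<omega> \<in> homs H G" "\<omega>' \<in> homs H G" and eq: "\<Psi> \<omega> = \<Psi> \<omega>'"
    show "\<omega> = \<omega>'"
    proof (rule assignments_eqI)
      show "\<omega> \<in> assignments H (V1 G) (V2 G)" "\<omega>' \<in> assignments H (V1 G) (V2 G)"
        using h by (auto simp: homs_def)
      then show "\<omega> (Inl v) = \<omega>' (Inl v)" if "v \<in> V1 H" for v
        using fun_cong[OF eq, of "Inl v"] that Aut(1) by (auto simp: \<Psi>_simps assignments_iff dest: inj_onD)
      show "\<omega> (Inr w) = \<omega>' (Inr w)" if "w \<in> V2 H" for w
        using fun_cong[OF eq, of "Inr w"] that Aut(2) h
        by (auto simp: \<Psi>_simps homs_iff assignments_iff dest: inj_onD)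
    qed
  qed
  moreover have "\<Psi> ` homs H G \<subseteq> homs H G"
  proof (intro image_subsetI)
    fix \<omega> assume "\<omega> \<in> homs H G"
    moreover have "\<Psi> \<omega> \<in> extensional (V1 H <+> V2 H)" by (simp add: \<Psi>_def)
    ultimately show "\<Psi> \<omega> \<in> homs H G"
      using Aut by (auto simp: homs_iff assignments_iff \<Psi>_simps mem)
  qed
  ultimately have "map_pmf \<Psi> (pmf_of_set (homs H G)) = pmf_of_set (homs H G)"
    using fin ne endo_inj_surj[OF fin, of \<Psi>] by (simp add: map_pmf_of_set_inj)
  moreover have "map_prod f g (edge_value e \<omega>) = edge_value e (\<Psi> \<omega>)" for \<omega>
    using mem[of "fst e" "snd e"] e by (simp add: edge_value_def \<Psi>_simps)
  then have "map_pmf (map_prod f g) (map_pmf (edge_value e) (pmf_of_set (homs H G))) =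
    map_pmf (edge_value e) (map_pmf \<Psi> (pmf_of_set (homs H G)))"
    by (simp add: pmf.map_comp o_def)
  ultimately have "map_pmf (map_prod f g) (map_pmf (edge_value e) (pmf_of_set (homs H G))) =
    map_pmf (edge_value e) (pmf_of_set (homs H G))"
    by simp
  moreover have "inj_on (map_prod f g) (edges G)"
    using map_prod_inj_on[OF Aut(1,2)] G'(3) by (rule inj_on_subset)
  ultimately show "\<exists>k. inj_on k (edges G) \<and> map_pmf k (map_pmf (edge_value e) (pmf_of_set (homs H G))) =
      map_pmf (edge_value e) (pmf_of_set (homs H G)) \<and> k x = y"
    using fg(2) by blast
qed

text \<open>Prescribed edge marginals force every outcome of a member of \<open>Q\<close> to be a
  homomorphism, which bounds its entropy by \<open>ln (real (card (homs H G)))\<close>. The uniform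
  distribution on \<open>homs H G\<close> is itself a member and attains the bound.\<close>

lemma m_edge_law:
  assumes G: "G \<in> bigraphs0" and trans: "edge_vertex_transitive G" and H: "H \<in> M2"
  shows "m H (edge_law G) = ln (real (card (homs H G)))"
proof -
  note G' = bigraphs0_D[OF G] and H' = M2_D[OF H]
  have fin: "finite (homs H G)" and ne: "homs H G \<noteq> {}"
    using finite_homs homs_nonempty[OF G] G' H' by auto
  have uniform: "pmf_of_set (homs H G) \<in> Q H (edge_law G)"
    using fin ne map_edge_value_uniform_homs[OF G trans H]
    by (auto simp: Q_iff edge_law_def homs_def)
  have "shannon_entropy q \<le> ln (real (card (homs H G)))" if q: "q \<in> Q H (edge_law G)" for q
  proof (rule shannon_entropy_le_ln_card[OF fin], rule subsetI)
    fix \<omega> assume \<omega>: "\<omega> \<in> set_pmf q"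
    have "edge_value e \<omega> \<in> edges G" if "e \<in> edges H" for e
    proof -
      have "edge_value e \<omega> \<in> set_pmf (map_pmf (edge_value e) q)" using \<omega> by simp
      then show ?thesis using q that G' by (simp add: Q_iff edge_law_def del: set_map_pmf)
    qed
    then show "\<omega> \<in> homs H G" using q \<omega> by (auto simp: homs_def Q_iff edge_law_def)
  qed
  then show ?thesis
    unfolding m_def using shannon_entropy_pmf_of_set[OF fin ne] uniform
    by (intro cSup_eq_maximum) force+
qed

text \<open>The logarithm of the density takes the shape of \<open>dstar\<close>, with logarithms of
  cardinalities in place of entropies.\<close>

lemma d_eq_homs:
  assumes G: "G \<in> bigraphs0" and H: "H \<in> M2"
  shows "d H G = - ln (real (card (homs H G))) +
    (real (card (V1 H)) * ln (real (card (V1 G))) + real (card (V2 H)) * ln (real (card (V2 G))))"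
proof -
  note G' = bigraphs0_D[OF G] and H' = M2_D[OF H]
  have "finite (homs H G)" "homs H G \<noteq> {}"
    using finite_homs homs_nonempty[OF G] G' H' by auto
  then have "0 < card (homs H G)" "0 < card (V1 G)" "0 < card (V2 G)"
    using G' by (auto simp: card_gt_0_iff)
  then show ?thesis
    unfolding d_def hom_density_def card_homs[OF H'(3), symmetric]
    by (simp add: ln_div ln_mult ln_realpow)
qed

text \<open>The conventions for the degenerate cases correspond: the marginals are uniform, so their
  product is the uniform law on all pairs, and it equals the edge law exactly when \<open>G\<close>
  is complete.\<close>

lemma hstar_edge_law:
  assumes G: "G \<in> bigraphs0" and trans: "edge_vertex_transitive G" and H: "H \<in> M2"
  shows "hstar H (edge_law G) = h H G"
proof -
  note G' = bigraphs0_D[OF G]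
  have dstar: "dstar H' (edge_law G) = d H' G" if "H' \<in> M2" for H'
    using G' by (simp add: dstar_def m_edge_law[OF G trans that] d_eq_homs[OF G that]
        law1_edge_law[OF G trans] law2_edge_law[OF G trans] shannon_entropy_pmf_of_set)
  have "pair_pmf (pmf_of_set (V1 G)) (pmf_of_set (V2 G)) = pmf_of_set (V1 G \<times> V2 G)"
  proof (rule pmf_eqI)
    fix z
    show "pmf (pair_pmf (pmf_of_set (V1 G)) (pmf_of_set (V2 G))) z = pmf (pmf_of_set (V1 G \<times> V2 G)) z"
      using G' by (cases z) (simp add: pmf_pair indicator_def)
  qed
  moreover have "pmf_of_set (edges G) = pmf_of_set (V1 G \<times> V2 G) \<longleftrightarrow> edges G = V1 G \<times> V2 G"
    using G' by (metis finite_cartesian_product set_pmf_of_set Times_empty)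
  ultimately have "independent (edge_law G) \<longleftrightarrow> edges G = V1 G \<times> V2 G"
    unfolding independent_iff_pair_pmf law1_edge_law[OF G trans] law2_edge_law[OF G trans]
    by (simp add: edge_law_def)
  then show ?thesis
    by (simp add: hstar_def h_def dstar[OF H] dstar[OF P1_in_M2])
qed

lemma P1_transitive: "edge_vertex_transitive P1" "P1 \<in> bigraphs0"
proof -
  have "(id, id) \<in> Aut P1" by (simp add: Aut_def)
  then show "edge_vertex_transitive P1"
    by (auto simp: edge_vertex_transitive_def P1_def intro: bexI[of _ "(id, id)"])
  show "P1 \<in> bigraphs0" using P1_in_M2 by (simp add: M2_def)
qed

section \<open>Counting sequences of a given type\<close>

text \<open>A crude form of Stirling's formula, by induction with \<open>ln t \<le> t - 1\<close> at
  the ratios (n+1)/n and n/(n+1). A logarithmic error suffices, as it is later divided by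
  \<open>n\<close>.\<close>

lemma ln_fact_bounds:
  shows "real n * ln (real n) - real n \<le> ln (fact n)"
    and "0 < n \<Longrightarrow> ln (fact n) \<le> real n * ln (real n) - real n + ln (real n) + 1"
proof -
  have step: "real n * (ln (real (Suc n)) - ln (real n)) \<le> 1"
    "1 \<le> real (Suc n) * (ln (real (Suc n)) - ln (real n))" if "0 < n" for n
  proof -
    have "ln (real (Suc n) / real n) \<le> real (Suc n) / real n - 1"
      using that by (intro ln_le_minus_one) simp
    then show "real n * (ln (real (Suc n)) - ln (real n)) \<le> 1"
      using that by (simp add: ln_div field_simps)
    have "ln (real n / real (Suc n)) \<le> real n / real (Suc n) - 1"
      using that by (intro ln_le_minus_one) simp
    then show "1 \<le> real (Suc n) * (ln (real (Suc n)) - ln (real n))"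
      using that by (simp add: ln_div field_simps)
  qed
  have fact: "ln (fact (Suc n) :: real) = ln (real (Suc n)) + ln (fact n)" for n
    by (subst fact_Suc) (simp add: ln_mult del: of_nat_Suc fact_Suc)
  show "real n * ln (real n) - real n \<le> ln (fact n)"
  proof (induction n)
    case (Suc n)
    then show ?case
      using step(1)[of n] by (cases "n = 0") (simp_all add: fact algebra_simps del: fact_Suc)
  qed simp
  show "ln (fact n) \<le> real n * ln (real n) - real n + ln (real n) + 1" if "0 < n"
    using that
  proof (induction n)
    case (Suc n)
    then show ?case
      using step(2)[of n] by (cases "n = 0") (simp_all add: fact algebra_simps del: fact_Suc)
  qed simp
qed

text \<open>The number of arrangements is a multinomial coefficient. In its logarithm the linear
  Stirling terms cancel, since the counts sum to \<open>n\<close>, and the main terms give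
  \<open>n\<close> times the entropy. One error arises from the numerator and one from each letter
  of \<open>A\<close>, which explains the factor \<open>card A + 1\<close>.\<close>

lemma ln_card_permutations_of_multiset:
  assumes A: "finite A" "set_mset T \<subseteq> A" and "T \<noteq> {#}"
  shows "\<bar>ln (real (card (permutations_of_multiset T))) - real (size T) * shannon_entropy (pmf_of_multiset T)\<bar>
    \<le> (real (card A) + 1) * (ln (real (size T)) + 1)"
proof -
  define n where "n = size T"
  define c where "c x = real (count T x)" for x
  define E where "E k = ln (fact k) - (real k * ln (real k) - real k)" for k :: nat
  have n: "0 < n" using assms(3) by (simp add: n_def nonempty_has_size)
  have E: "0 \<le> E k" "E k \<le> ln (real n) + 1" if "k \<le> n" for k
  proof -
    show "0 \<le> E k" using ln_fact_bounds(1)[of k] by (simp add: E_def)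
    show "E k \<le> ln (real n) + 1"
    proof (cases "k = 0")
      case False
      then have "ln (real k) \<le> ln (real n)" using that by simp
      then show ?thesis using ln_fact_bounds(2)[of k] False by (simp add: E_def)
    qed (use n in \<open>simp add: E_def\<close>)
  qed
  have sum_c: "(\<Sum>x\<in>A. c x) = real n"
    unfolding n_def c_def size_multiset_overloaded_eq of_nat_sum
    using A by (intro sum.mono_neutral_right) (auto simp: not_in_iff)
  \<comment> \<open>Letters of \<open>A\<close> that do not occur in \<open>T\<close> contribute the
    factor 0! = 1.\<close>
  have prod: "(\<Prod>x\<in>set_mset T. fact (count T x)) = (\<Prod>x\<in>A. fact (count T x) :: nat)"
    using A by (intro prod.mono_neutral_left) (auto simp: not_in_iff)
  have pos: "0 < card (permutations_of_multiset T)"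
    by (simp add: card_gt_0_iff)
  have "real (card (permutations_of_multiset T) * (\<Prod>x\<in>A. fact (count T x))) = fact n"
    using card_permutations_of_multiset_aux[of T] unfolding prod n_def by simp
  then have "real (card (permutations_of_multiset T)) * (\<Prod>x\<in>A. fact (count T x)) = fact n"
    by simp
  then have "ln (real (card (permutations_of_multiset T))) + ln (\<Prod>x\<in>A. fact (count T x)) = ln (fact n)"
    using pos ln_mult[of "real (card (permutations_of_multiset T))" "\<Prod>x\<in>A. fact (count T x)"]
    by (simp add: A(1))
  also have "ln (\<Prod>x\<in>A. fact (count T x) :: real) = (\<Sum>x\<in>A. ln (fact (count T x)))"
    using A by (intro ln_prod) auto
  finally have 1: "ln (real (card (permutations_of_multiset T))) =
      ln (fact n) - (\<Sum>x\<in>A. ln (fact (count T x)))"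
    by simp
  have "set_pmf (pmf_of_multiset T) \<subseteq> A" using assms by simp
  then have "real n * shannon_entropy (pmf_of_multiset T) =
      - (\<Sum>x\<in>A. real n * (c x / real n * ln (c x / real n)))"
    using A assms(3)
    by (simp add: shannon_entropy_eq_sum_superset[of A] c_def n_def sum_distrib_left)
  also have "(\<Sum>x\<in>A. real n * (c x / real n * ln (c x / real n))) = (\<Sum>x\<in>A. c x * ln (c x) - c x * ln (real n))"
    using n by (intro sum.cong) (auto simp: c_def ln_div not_in_iff algebra_simps)
  also have "\<dots> = (\<Sum>x\<in>A. c x * ln (c x)) - real n * ln (real n)"
    by (simp add: sum_subtractf sum_distrib_right[symmetric] sum_c)
  finally have 2: "real n * shannon_entropy (pmf_of_multiset T) = real n * ln (real n) - (\<Sum>x\<in>A. c x * ln (c x))"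
    by simp
  have "(\<Sum>x\<in>A. ln (fact (count T x))) = (\<Sum>x\<in>A. c x * ln (c x)) - real n + (\<Sum>x\<in>A. E (count T x))"
    by (simp add: E_def c_def[symmetric] sum_subtractf sum.distrib sum_c)
  then have 3: "ln (real (card (permutations_of_multiset T))) - real n * shannon_entropy (pmf_of_multiset T) =
    E n - (\<Sum>x\<in>A. E (count T x))"
    unfolding 1 2 by (simp add: E_def)
  have count_le: "count T x \<le> n" for x by (simp add: n_def count_le_size)
  have "0 \<le> (\<Sum>x\<in>A. E (count T x))"
    using E(1)[OF count_le] by (intro sum_nonneg)
  moreover have "(\<Sum>x\<in>A. E (count T x)) \<le> real (card A) * (ln (real n) + 1)"
    using E(2)[OF count_le] by (intro sum_bounded_above)
  moreover have "0 \<le> ln (real n)" using n by simp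
  then have "0 \<le> real (card A) * (ln (real n) + 1)" by simp
  ultimately have "\<bar>E n - (\<Sum>x\<in>A. E (count T x))\<bar> \<le> real (card A) * (ln (real n) + 1) + (ln (real n) + 1)"
    using E[of n] by linarith
  then show ?thesis
    unfolding n_def[symmetric] 3 by (simp add: algebra_simps)
qed

text \<open>A multiset over \<open>A\<close> is determined by its counts on \<open>A\<close>, each
  at most \<open>n\<close>. For fixed \<open>A\<close> the number of types is thus polynomial in
  \<open>n\<close>.\<close>

lemma card_multisets_le:
  assumes "finite A"
  shows "finite {T. set_mset T \<subseteq> A \<and> size T = n}"
    and "card {T. set_mset T \<subseteq> A \<and> size T = n} \<le> (n + 1) ^ card A"
proof -
  let ?\<T> = "{T. set_mset T \<subseteq> A \<and> size T = n}"
  have inj: "inj_on (\<lambda>T. restrict (count T) A) ?\<T>"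
  proof (rule inj_onI, rule multiset_eqI)
    fix S T x assume *: "S \<in> ?\<T>" "T \<in> ?\<T>" "restrict (count S) A = restrict (count T) A"
    show "count S x = count T x"
    proof (cases "x \<in> A")
      case True
      then show ?thesis using fun_cong[OF *(3), of x] by simp
    next
      case False
      then have "x \<notin># S" "x \<notin># T" using * by auto
      then show ?thesis by (simp add: not_in_iff)
    qed
  qed
  have sub: "(\<lambda>T. restrict (count T) A) ` ?\<T> \<subseteq> A \<rightarrow>\<^sub>E {..n}"
    using count_le_size by auto
  have fin: "finite (A \<rightarrow>\<^sub>E {..n})" using assms by (intro finite_PiE) auto
  show "finite ?\<T>" using inj_on_finite[OF inj sub fin] .
  show "card ?\<T> \<le> (n + 1) ^ card A"
    using card_inj_on_le[OF inj sub fin] by (simp add: card_PiE assms)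
qed

section \<open>Type graphs\<close>

text \<open>Vertices have to be natural numbers, so sequences are coded by \<open>to_nat\<close>. A
  sequence of pairs joins the sequence of its first entries to that of its second entries.\<close>

definition type_graph :: "(nat \<times> nat) multiset \<Rightarrow> bigraph" where
  "type_graph M =
     \<lparr>V1 = to_nat ` permutations_of_multiset (image_mset fst M),
      V2 = to_nat ` permutations_of_multiset (image_mset snd M),
      edges = (\<lambda>zs. (to_nat (map fst zs), to_nat (map snd zs))) ` permutations_of_multiset M\<rparr>"

lemma V1_type_graph_iff: "to_nat xs \<in> V1 (type_graph M) \<longleftrightarrow> mset xs = image_mset fst M"
  by (auto simp: type_graph_def permutations_of_multiset_def)

lemma V2_type_graph_iff: "to_nat ys \<in> V2 (type_graph M) \<longleftrightarrow> mset ys = image_mset snd M"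
  by (auto simp: type_graph_def permutations_of_multiset_def)

lemma V1_type_graphE:
  assumes "k \<in> V1 (type_graph M)"
  obtains xs where "k = to_nat xs" "mset xs = image_mset fst M" "length xs = size M"
proof -
  obtain xs where xs: "k = to_nat xs" "mset xs = image_mset fst M"
    using assms by (auto simp: type_graph_def permutations_of_multiset_def)
  then have "size (mset xs) = size M" by simp
  then have "length xs = size M" by simp
  with xs show thesis by (rule that)
qed

lemma V2_type_graphE:
  assumes "k \<in> V2 (type_graph M)"
  obtains ys where "k = to_nat ys" "mset ys = image_mset snd M" "length ys = size M"
proof -
  obtain xs where xs: "k = to_nat xs" "mset xs = image_mset snd M"
    using assms by (auto simp: type_graph_def permutations_of_multiset_def)
  then have "size (mset xs) = size M" by simp
  then have "length xs = size M" by simp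
  with xs show thesis by (rule that)
qed

text \<open>Equal length has to be stated because \<open>zip\<close> truncates the longer
  list.\<close>

lemma edges_type_graph_iff:
  "(to_nat xs, to_nat ys) \<in> edges (type_graph M) \<longleftrightarrow> length xs = length ys \<and> mset (zip xs ys) = M"
proof
  assume "(to_nat xs, to_nat ys) \<in> edges (type_graph M)"
  then obtain zs where "xs = map fst zs" "ys = map snd zs" "mset zs = M"
    by (auto simp: type_graph_def permutations_of_multiset_def)
  then show "length xs = length ys \<and> mset (zip xs ys) = M"
    by (simp add: zip_map_fst_snd)
next
  assume *: "length xs = length ys \<and> mset (zip xs ys) = M"
  then have "xs = map fst (zip xs ys)" "ys = map snd (zip xs ys)" by simp_all
  then show "(to_nat xs, to_nat ys) \<in> edges (type_graph M)"
    using * by (force simp: type_graph_def permutations_of_multiset_def)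
qed

lemma edges_type_graphE:
  assumes "e \<in> edges (type_graph M)"
  obtains zs where "e = (to_nat (map fst zs), to_nat (map snd zs))" "mset zs = M"
  using assms by (auto simp: type_graph_def permutations_of_multiset_def)

lemma type_graph_in_bigraphs0: "type_graph M \<in> bigraphs0"
proof -
  have "permutations_of_multiset M \<noteq> {}" by simp
  then have "edges (type_graph M) \<noteq> {}" by (simp add: type_graph_def)
  moreover have "edges (type_graph M) \<subseteq> V1 (type_graph M) \<times> V2 (type_graph M)"
  proof
    fix e assume "e \<in> edges (type_graph M)"
    then obtain zs where "e = (to_nat (map fst zs), to_nat (map snd zs))" "mset zs = M"
      by (rule edges_type_graphE)
    then show "e \<in> V1 (type_graph M) \<times> V2 (type_graph M)"
      by (auto simp: V1_type_graph_iff V2_type_graph_iff)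
  qed
  ultimately show ?thesis
    by (auto simp: bigraphs0_def bigraphs_def type_graph_def)
qed

lemma card_V_type_graph:
  "card (V1 (type_graph M)) = card (permutations_of_multiset (image_mset fst M))"
  "card (V2 (type_graph M)) = card (permutations_of_multiset (image_mset snd M))"
  by (simp_all add: type_graph_def card_image)

text \<open>The action of a permutation of positions on coded sequences; the same map acts on both
  classes.\<close>

definition permute_code :: "(nat \<Rightarrow> nat) \<Rightarrow> nat \<Rightarrow> nat" where
  "permute_code \<pi> k = to_nat (permute_list \<pi> (from_nat k :: nat list))"

lemma permute_code_to_nat:
  "permute_code \<pi> (to_nat xs) = to_nat (permute_list \<pi> xs)" for xs :: "nat list"
  by (simp add: permute_code_def)

lemma permute_list_inject:
  assumes "\<pi> permutes {..<n}" "length xs = n" "length ys = n" "permute_list \<pi> xs = permute_list \<pi> ys"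
  shows "xs = ys"
proof (rule nth_equalityI)
  fix i assume i: "i < length xs"
  then obtain j where j: "j < n" "\<pi> j = i"
    using assms(1,2) permutes_image[OF assms(1)] by (metis imageE lessThan_iff)
  have "permute_list \<pi> xs ! j = xs ! i" "permute_list \<pi> ys ! j = ys ! i"
    using assms(1-3) j by (simp_all add: permute_list_nth)
  then show "xs ! i = ys ! i" using assms(4) by simp
qed (use assms in simp)

text \<open>Rearranging positions changes no type, and rearranging both ends in the same way
  rearranges the zipped sequence, so joint types are preserved too. Finiteness turns injectivity
  into bijectivity.\<close>

lemma permute_code_Aut:
  assumes \<pi>: "\<pi> permutes {..<size M}"
  shows "(permute_code \<pi>, permute_code \<pi>) \<in> Aut (type_graph M)"
proof -
  note G = type_graph_in_bigraphs0[of M]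
  have "bij_betw (permute_code \<pi>) (V1 (type_graph M)) (V1 (type_graph M))"
  proof -
    have "permute_code \<pi> ` V1 (type_graph M) \<subseteq> V1 (type_graph M)"
      using \<pi> by (auto simp: permute_code_to_nat V1_type_graph_iff elim!: V1_type_graphE)
    moreover have "inj_on (permute_code \<pi>) (V1 (type_graph M))"
      using permute_list_inject[OF \<pi>]
      by (auto simp: permute_code_to_nat elim!: V1_type_graphE intro!: inj_onI)
    ultimately show ?thesis
      using bigraphs0_D[OF G] by (simp add: bij_betw_def endo_inj_surj)
  qed
  moreover have "bij_betw (permute_code \<pi>) (V2 (type_graph M)) (V2 (type_graph M))"
  proof -
    have "permute_code \<pi> ` V2 (type_graph M) \<subseteq> V2 (type_graph M)"
      using \<pi> by (auto simp: permute_code_to_nat V2_type_graph_iff elim!: V2_type_graphE)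
    moreover have "inj_on (permute_code \<pi>) (V2 (type_graph M))"
      using permute_list_inject[OF \<pi>]
      by (auto simp: permute_code_to_nat elim!: V2_type_graphE intro!: inj_onI)
    ultimately show ?thesis
      using bigraphs0_D[OF G] by (simp add: bij_betw_def endo_inj_surj)
  qed
  moreover have "(permute_code \<pi> v, permute_code \<pi> w) \<in> edges (type_graph M) \<longleftrightarrow> (v, w) \<in> edges (type_graph M)"
    if vw: "v \<in> V1 (type_graph M)" "w \<in> V2 (type_graph M)" for v w
  proof -
    obtain xs where xs: "v = to_nat xs" "mset xs = image_mset fst M" "length xs = size M"
      using vw(1) by (rule V1_type_graphE)
    obtain ys where ys: "w = to_nat ys" "mset ys = image_mset snd M" "length ys = size M"
      using vw(2) by (rule V2_type_graphE)
    have "zip (permute_list \<pi> xs) (permute_list \<pi> ys) = permute_list \<pi> (zip xs ys)"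
      using \<pi> xs ys by (intro permute_list_zip[symmetric]) auto
    then show ?thesis
      using \<pi> xs ys by (simp add: permute_code_to_nat edges_type_graph_iff)
  qed
  ultimately show ?thesis by (simp add: Aut_def)
qed

text \<open>Two sequences with the same multiset of entries differ by a permutation of positions.
  Applied to sequences of pairs, this moves both ends of an edge at once.\<close>

lemma type_graph_transitive: "edge_vertex_transitive (type_graph M)"
proof -
  have V1: "\<exists>(f, g)\<in>Aut (type_graph M). f v = v'"
    if v: "v \<in> V1 (type_graph M)" "v' \<in> V1 (type_graph M)" for v v'
  proof -
    obtain xs where xs: "v = to_nat xs" "mset xs = image_mset fst M" "length xs = size M"
      using v(1) by (rule V1_type_graphE)
    obtain xs' where xs': "v' = to_nat xs'" "mset xs' = image_mset fst M"
      using v(2) by (rule V1_type_graphE)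
    obtain \<pi> where "\<pi> permutes {..<length xs}" "permute_list \<pi> xs = xs'"
      using mset_eq_permutation[of xs' xs] xs xs' by auto
    then show ?thesis
      using permute_code_Aut[of \<pi> M] xs xs'
      by (intro bexI[of _ "(permute_code \<pi>, permute_code \<pi>)"]) (auto simp: permute_code_to_nat)
  qed
  have V2: "\<exists>(f, g)\<in>Aut (type_graph M). g w = w'"
    if w: "w \<in> V2 (type_graph M)" "w' \<in> V2 (type_graph M)" for w w'
  proof -
    obtain xs where xs: "w = to_nat xs" "mset xs = image_mset snd M" "length xs = size M"
      using w(1) by (rule V2_type_graphE)
    obtain xs' where xs': "w' = to_nat xs'" "mset xs' = image_mset snd M"
      using w(2) by (rule V2_type_graphE)
    obtain \<pi> where "\<pi> permutes {..<length xs}" "permute_list \<pi> xs = xs'"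
      using mset_eq_permutation[of xs' xs] xs xs' by auto
    then show ?thesis
      using permute_code_Aut[of \<pi> M] xs xs'
      by (intro bexI[of _ "(permute_code \<pi>, permute_code \<pi>)"]) (auto simp: permute_code_to_nat)
  qed
  have E: "\<exists>(f, g)\<in>Aut (type_graph M). f v = v' \<and> g w = w'"
    if e: "(v, w) \<in> edges (type_graph M)" "(v', w') \<in> edges (type_graph M)" for v w v' w'
  proof -
    obtain zs where zs: "(v, w) = (to_nat (map fst zs), to_nat (map snd zs))" "mset zs = M"
      using e(1) by (rule edges_type_graphE)
    obtain zs' where zs': "(v', w') = (to_nat (map fst zs'), to_nat (map snd zs'))" "mset zs' = M"
      using e(2) by (rule edges_type_graphE)
    have "length zs = size M" using zs(2) by auto
    obtain \<pi> where \<pi>: "\<pi> permutes {..<length zs}" "permute_list \<pi> zs = zs'"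
      using mset_eq_permutation[of zs' zs] zs(2) zs'(2) by auto
    have "(permute_code \<pi>, permute_code \<pi>) \<in> Aut (type_graph M)"
      using permute_code_Aut \<pi>(1) \<open>length zs = size M\<close> by simp
    moreover have "permute_code \<pi> v = v'" "permute_code \<pi> w = w'"
      using zs(1) zs'(1) \<pi> by (auto simp: permute_code_to_nat permute_list_map)
    ultimately show ?thesis by (intro bexI[of _ "(permute_code \<pi>, permute_code \<pi>)"]) auto
  qed
  show ?thesis
    unfolding edge_vertex_transitive_def using V1 V2 E by auto
qed

text \<open>Transposition: a homomorphism gives each vertex of \<open>H\<close> a sequence of length
  \<open>size M\<close>, and reading it position by position gives a sequence of assignments. Since
  no vertex of \<open>H\<close> is isolated, the edge conditions already fix the type of the
  sequence at each vertex.\<close>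

lemma card_homs_type_graph:
  assumes H: "H \<in> M2" and M: "set_mset M \<subseteq> A \<times> B"
  shows "card (homs H (type_graph M)) =
    card {zs. set zs \<subseteq> assignments H A B \<and> (\<forall>e\<in>edges H. mset (map (edge_value e) zs) = M)}"
    (is "_ = card ?Z")
proof -
  note H' = M2_D[OF H]
  have mem: "v \<in> V1 H" "w \<in> V2 H" if "(v, w) \<in> edges H" for v w using H'(3) that by auto
  define \<Phi> where "\<Phi> zs = (\<lambda>x\<in>V1 H <+> V2 H. to_nat (map (\<lambda>\<omega>. \<omega> x) zs))"
    for zs :: "(nat + nat \<Rightarrow> nat) list"
  have len: "length zs = size M" if "zs \<in> ?Z" for zs
  proof -
    obtain e where "e \<in> edges H" using H'(4) by auto
    then have "size (mset (map (edge_value e) zs)) = size M" using that by auto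
    then show ?thesis by simp
  qed
  have "inj_on \<Phi> ?Z"
  proof (rule inj_onI)
    fix zs zs' assume zs: "zs \<in> ?Z" "zs' \<in> ?Z" and eq: "\<Phi> zs = \<Phi> zs'"
    have coord: "map (\<lambda>\<omega>. \<omega> x) zs = map (\<lambda>\<omega>. \<omega> x) zs'" if "x \<in> V1 H <+> V2 H" for x
      using fun_cong[OF eq, of x] that by (simp add: \<Phi>_def)
    show "zs = zs'"
    proof (rule nth_equalityI)
      show "length zs = length zs'" using len zs by simp
      fix i assume i: "i < length zs"
      then have i': "i < length zs'" using len zs by simp
      have "(zs ! i) x = (zs' ! i) x" if "x \<in> V1 H <+> V2 H" for x
        using arg_cong[OF coord[OF that], of "\<lambda>xs. xs ! i"] i i' by simp
      moreover have "zs ! i \<in> assignments H A B" "zs' ! i \<in> assignments H A B"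
        using zs nth_mem[OF i] nth_mem[OF i'] by auto
      ultimately show "zs ! i = zs' ! i" by (intro assignments_eqI) auto
    qed
  qed
  moreover have "\<Phi> ` ?Z = homs H (type_graph M)"
  proof (intro equalityI subsetI)
    fix \<omega> assume "\<omega> \<in> \<Phi> ` ?Z"
    then obtain zs where zs: "zs \<in> ?Z" and \<omega>: "\<omega> = \<Phi> zs" by auto
    have e: "mset (map (\<lambda>\<omega>. (\<omega> (Inl v), \<omega> (Inr w))) zs) = M" if "(v, w) \<in> edges H" for v w
    proof -
      have "mset (map (edge_value (v, w)) zs) = M" using zs that by blast
      moreover have "edge_value (v, w) = (\<lambda>\<omega>. (\<omega> (Inl v), \<omega> (Inr w)))" by (simp add: edge_value_def fun_eq_iff)
      ultimately show ?thesis by simp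
    qed
    have "\<omega> (Inl v) \<in> V1 (type_graph M)" if v: "v \<in> V1 H" for v
    proof -
      obtain w where "(v, w) \<in> edges H" using H'(6)[OF v] by auto
      from e[OF this] have "mset (map (\<lambda>\<omega>. \<omega> (Inl v)) zs) = image_mset fst M"
        by (auto simp: multiset.map_comp o_def)
      then show ?thesis using v by (simp add: \<omega> \<Phi>_def V1_type_graph_iff InlI)
    qed
    moreover have "\<omega> (Inr w) \<in> V2 (type_graph M)" if w: "w \<in> V2 H" for w
    proof -
      obtain v where "(v, w) \<in> edges H" using H'(7)[OF w] by auto
      from e[OF this] have "mset (map (\<lambda>\<omega>. \<omega> (Inr w)) zs) = image_mset snd M"
        by (auto simp: multiset.map_comp o_def)
      then show ?thesis using w by (simp add: \<omega> \<Phi>_def V2_type_graph_iff InrI)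
    qed
    moreover have "(\<omega> (Inl v), \<omega> (Inr w)) \<in> edges (type_graph M)" if "(v, w) \<in> edges H" for v w
    proof -
      have "zip (map (\<lambda>\<omega>. \<omega> (Inl v)) zs) (map (\<lambda>\<omega>. \<omega> (Inr w)) zs) = map (\<lambda>\<omega>. (\<omega> (Inl v), \<omega> (Inr w))) zs"
        by (simp add: zip_map1 zip_map2 zip_same_conv_map)
      then show ?thesis
        using e[OF that] mem[OF that] by (simp add: \<omega> \<Phi>_def edges_type_graph_iff InlI InrI)
    qed
    ultimately show "\<omega> \<in> homs H (type_graph M)"
      by (auto simp: homs_iff assignments_iff \<omega> \<Phi>_def)
  next
    fix \<omega> assume \<omega>: "\<omega> \<in> homs H (type_graph M)"
    define L where "L x = (from_nat (\<omega> x) :: nat list)" for x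
    define n where "n = size M"
    have L1: "\<omega> (Inl v) = to_nat (L (Inl v)) \<and> length (L (Inl v)) = n \<and> set (L (Inl v)) \<subseteq> A"
      if "v \<in> V1 H" for v
    proof -
      have "\<omega> (Inl v) \<in> V1 (type_graph M)" using \<omega> that by (auto simp: homs_iff assignments_iff)
      then obtain xs where xs: "\<omega> (Inl v) = to_nat xs" "mset xs = image_mset fst M" "length xs = n"
        unfolding n_def by (rule V1_type_graphE)
      have "set xs = fst ` set_mset M" using arg_cong[OF xs(2), of set_mset] by simp
      then show ?thesis using xs M by (auto simp: L_def)
    qed
    have L2: "\<omega> (Inr w) = to_nat (L (Inr w)) \<and> length (L (Inr w)) = n \<and> set (L (Inr w)) \<subseteq> B"
      if "w \<in> V2 H" for w
    proof -
      have "\<omega> (Inr w) \<in> V2 (type_graph M)" using \<omega> that by (auto simp: homs_iff assignments_iff)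
      then obtain xs where xs: "\<omega> (Inr w) = to_nat xs" "mset xs = image_mset snd M" "length xs = n"
        unfolding n_def by (rule V2_type_graphE)
      have "set xs = snd ` set_mset M" using arg_cong[OF xs(2), of set_mset] by simp
      then show ?thesis using xs M by (auto simp: L_def)
    qed
    \<comment> \<open>The inverse transposition collects the \<open>i\<close>-th entries of all
      decoded sequences into one assignment.\<close>
    define zs where "zs = map (\<lambda>i. \<lambda>x\<in>V1 H <+> V2 H. L x ! i) [0..<n]"
    have "set zs \<subseteq> assignments H A B"
    proof -
      have "(\<lambda>x\<in>V1 H <+> V2 H. L x ! i) \<in> assignments H A B" if i: "i < n" for i
      proof -
        have "L (Inl v) ! i \<in> A" if "v \<in> V1 H" for v
          using L1[OF that] nth_mem[of i "L (Inl v)"] i by auto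
        moreover have "L (Inr w) ! i \<in> B" if "w \<in> V2 H" for w
          using L2[OF that] nth_mem[of i "L (Inr w)"] i by auto
        ultimately show ?thesis by (simp add: assignments_iff InlI InrI)
      qed
      then show ?thesis by (auto simp: zs_def)
    qed
    moreover have "mset (map (edge_value e) zs) = M" if "e \<in> edges H" for e
    proof -
      obtain v w where e: "e = (v, w)" by (cases e)
      have vw: "v \<in> V1 H" "w \<in> V2 H" using mem that e by auto
      have "(\<omega> (Inl v), \<omega> (Inr w)) \<in> edges (type_graph M)"
        using \<omega> that e by (simp add: homs_iff)
      then have "mset (zip (L (Inl v)) (L (Inr w))) = M"
        using L1[OF vw(1)] L2[OF vw(2)] by (metis edges_type_graph_iff)
      moreover have "map (edge_value e) zs = zip (L (Inl v)) (L (Inr w))"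
        using L1[OF vw(1)] L2[OF vw(2)] vw
        by (intro nth_equalityI) (auto simp: zs_def e edge_value_def)
      ultimately show ?thesis by simp
    qed
    moreover have "\<Phi> zs = \<omega>"
    proof (rule extensionalityI[of _ "V1 H <+> V2 H"])
      show "\<Phi> zs \<in> extensional (V1 H <+> V2 H)" by (simp add: \<Phi>_def)
      show "\<omega> \<in> extensional (V1 H <+> V2 H)" using \<omega> by (simp add: homs_iff assignments_iff)
      fix x assume x: "x \<in> V1 H <+> V2 H"
      then have "\<omega> x = to_nat (L x) \<and> length (L x) = n" using L1 L2 by auto
      moreover have "map (\<lambda>\<omega>. \<omega> x) zs = map (\<lambda>i. L x ! i) [0..<n]" using x by (simp add: zs_def)
      ultimately show "\<Phi> zs x = \<omega> x" using x map_nth[of "L x"] by (simp add: \<Phi>_def)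
    qed
    ultimately show "\<omega> \<in> \<Phi> ` ?Z" by blast
  qed
  ultimately have "bij_betw \<Phi> ?Z (homs H (type_graph M))" unfolding bij_betw_def by (rule conjI)
  then show ?thesis by (rule bij_betw_same_card[symmetric])
qed

text \<open>The sequences that encode homomorphisms split into type classes. Any single class gives
  a lower bound; the number of types times the largest class gives an upper bound.\<close>

lemma card_homs_type_graph_bounds:
  assumes H: "H \<in> M2" and AB: "finite A" "finite B" "set_mset M \<subseteq> A \<times> B"
  defines "\<T> \<equiv> {T. set_mset T \<subseteq> assignments H A B \<and> (\<forall>e\<in>edges H. image_mset (edge_value e) T = M)}"
  shows "T \<in> \<T> \<Longrightarrow> card (permutations_of_multiset T) \<le> card (homs H (type_graph M))"
    and "\<exists>T\<in>\<T>. card (homs H (type_graph M)) \<le>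
      (size M + 1) ^ card (assignments H A B) * card (permutations_of_multiset T)"
proof -
  note H' = M2_D[OF H]
  have finA: "finite (assignments H A B)" using finite_assignments AB H' by blast
  let ?Z = "{zs. set zs \<subseteq> assignments H A B \<and> (\<forall>e\<in>edges H. mset (map (edge_value e) zs) = M)}"
  have Z: "?Z = (\<Union>T\<in>\<T>. permutations_of_multiset T)"
    by (auto simp: \<T>_def permutations_of_multiset_def)
  note card = card_homs_type_graph[OF H AB(3)]
  \<comment> \<open>Since \<open>H\<close> has an edge, the image condition fixes the size of
    \<open>T\<close>.\<close>
  have "\<T> \<subseteq> {T. set_mset T \<subseteq> assignments H A B \<and> size T = size M}"
    using H'(4) by (auto simp: \<T>_def)
  note \<T> = finite_subset[OF this card_multisets_le(1)[OF finA]]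
    order_trans[OF card_mono[OF card_multisets_le(1)[OF finA] this] card_multisets_le(2)[OF finA]]
  have finZ: "finite ?Z" unfolding Z using \<T>(1) by auto
  show "card (permutations_of_multiset T) \<le> card (homs H (type_graph M))" if "T \<in> \<T>"
  proof -
    have "permutations_of_multiset T \<subseteq> ?Z" unfolding Z using that by blast
    then show ?thesis unfolding card using finZ by (intro card_mono)
  qed
  have "0 < card (homs H (type_graph M))"
    using homs_nonempty[OF type_graph_in_bigraphs0 H'(3)] bigraphs0_D[OF type_graph_in_bigraphs0[of M]]
      finite_homs[of H "type_graph M"] H' by (simp add: card_gt_0_iff)
  then have ne: "\<T> \<noteq> {}" unfolding card Z by auto
  define k where "k = Max ((\<lambda>T. card (permutations_of_multiset T)) ` \<T>)"
  have "k \<in> (\<lambda>T. card (permutations_of_multiset T)) ` \<T>"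
    unfolding k_def using \<T>(1) ne by (intro Max_in) auto
  then obtain T where T: "T \<in> \<T>" "k = card (permutations_of_multiset T)" by auto
  have "card (homs H (type_graph M)) \<le> (\<Sum>T\<in>\<T>. card (permutations_of_multiset T))"
    unfolding card Z using \<T>(1) by (rule card_UN_le)
  also have "\<dots> \<le> card \<T> * k"
    using \<T>(1) by (intro sum_bounded_above[of \<T> _ k, simplified]) (auto simp: k_def)
  also have "\<dots> \<le> (size M + 1) ^ card (assignments H A B) * k"
    using \<T>(2) by (intro mult_right_mono) auto
  finally show "\<exists>T\<in>\<T>. card (homs H (type_graph M)) \<le>
      (size M + 1) ^ card (assignments H A B) * card (permutations_of_multiset T)"
    using T by auto
qed

section \<open>Rational approximation and compactness\<close>

text \<open>Dirichlet's theorem at accuracy \<open>1 / real (N * k)\<close> yields a positive common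
  denominator; multiplying it by \<open>k\<close> makes it at least \<open>k\<close> and worsens the
  error only by the factor \<open>k\<close>.\<close>

lemma simultaneous_approximation:
  fixes S :: "real set" and N k :: nat
  assumes "finite S" "0 < N" "0 < k"
  obtains n :: nat and r :: "real \<Rightarrow> int"
    where "k \<le> n" "\<And>s. s \<in> S \<Longrightarrow> \<bar>real n * s - of_int (r s)\<bar> < 1 / real N"
proof -
  obtain f where f: "bij_betw f {0..<card S} S"
    using ex_bij_betw_nat_finite[OF assms(1)] by blast
  have "0 < N * k" using assms by simp
  then obtain q p where q: "0 < q"
    and p: "\<And>i. i < card S \<Longrightarrow> \<bar>of_int q * f i - of_int (p i)\<bar> < 1 / real (N * k)"
    by (rule Dirichlet_approx_simult[of "N * k" "card S" f]) blast
  define g where "g = inv_into {0..<card S} f"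
  show thesis
  proof (rule that[of "k * nat q" "\<lambda>s. int k * p (g s)"])
    have "1 \<le> nat q" using q by linarith
    then show "k \<le> k * nat q" by simp
    fix s assume "s \<in> S"
    then have "g s < card S" "f (g s) = s"
      using f bij_betw_inv_into_right[OF f] inv_into_into[of s f "{0..<card S}"]
      by (auto simp: g_def bij_betw_def)
    then have *: "\<bar>of_int q * s - of_int (p (g s))\<bar> < 1 / real (N * k)" using p by metis
    have "real (k * nat q) * s - of_int (int k * p (g s)) = real k * (of_int q * s - of_int (p (g s)))"
      using q by (simp add: algebra_simps)
    then have "\<bar>real (k * nat q) * s - of_int (int k * p (g s))\<bar> = real k * \<bar>of_int q * s - of_int (p (g s))\<bar>"
      by (simp add: abs_mult)
    also have "\<dots> < real k * (1 / real (N * k))" using * assms(3) by (intro mult_strict_left_mono) auto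
    also have "\<dots> = 1 / real N" using assms by simp
    finally show "\<bar>real (k * nat q) * s - of_int (int k * p (g s))\<bar> < 1 / real N" .
  qed
qed

section \<open>Rounding distributions to multisets\<close>

text \<open>The function \<open>r\<close> acts on probability values rather than on outcomes, so one
  \<open>r\<close> can round several distributions over different outcome spaces.\<close>

definition rounding :: "(real \<Rightarrow> int) \<Rightarrow> 'a pmf \<Rightarrow> 'a multiset" where
  "rounding r p = (\<Sum>x\<in>set_pmf p. replicate_mset (nat (r (pmf p x))) x)"

lemma count_rounding:
  assumes "finite (set_pmf p)"
  shows "count (rounding r p) x = (if x \<in> set_pmf p then nat (r (pmf p x)) else 0)"
  using assms by (simp add: rounding_def count_sum sum.delta if_distrib cong: if_cong)

lemma set_mset_rounding:
  assumes "finite (set_pmf p)"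
  shows "set_mset (rounding r p) \<subseteq> set_pmf p"
proof
  fix x assume "x \<in># rounding r p"
  then have "count (rounding r p) x \<noteq> 0" by (simp add: count_eq_zero_iff)
  then show "x \<in> set_pmf p" using assms by (simp add: count_rounding split: if_splits)
qed

lemma count_rounding_approx:
  assumes "finite (set_pmf p)" "0 < N"
    and r: "\<And>x. x \<in> set_pmf p \<Longrightarrow> \<bar>real n * pmf p x - of_int (r (pmf p x))\<bar> < 1 / real N"
  shows "\<bar>real n * pmf p x - real (count (rounding r p) x)\<bar> < 1 / real N"
proof (cases "x \<in> set_pmf p")
  case True
  have "1 / real N \<le> 1" using assms(2) by simp
  \<comment> \<open>An integer above -1 is nonnegative, so \<open>nat\<close> does not change the
    rounded value.\<close>
  moreover have "0 \<le> real n * pmf p x" by simp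
  ultimately have "-1 < real_of_int (r (pmf p x))" using r[OF True] by linarith
  then have "0 \<le> r (pmf p x)" by linarith
  then show ?thesis using r[OF True] True assms(1) by (simp add: count_rounding)
next
  case False
  then show ?thesis using assms by (simp add: count_rounding set_pmf_iff)
qed

text \<open>Both counts at \<open>y\<close> approximate \<open>real n * pmf p y\<close>. The errors
  over the fibre of \<open>y\<close> sum to at most \<open>card (set_pmf q) / N\<close>, and the
  direct error is below \<open>1 / N\<close>. By the choice of \<open>N\<close> the total stays
  below one, which turns the approximate identity into an exact one.\<close>

lemma image_mset_rounding:
  assumes q: "finite (set_pmf q)" and N: "card (set_pmf q) + 1 \<le> N" and p: "map_pmf f q = p"
    and rq: "\<And>x. x \<in> set_pmf q \<Longrightarrow> \<bar>real n * pmf q x - of_int (r (pmf q x))\<bar> < 1 / real N"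
    and rp: "\<And>y. y \<in> set_pmf p \<Longrightarrow> \<bar>real n * pmf p y - of_int (r (pmf p y))\<bar> < 1 / real N"
  shows "image_mset f (rounding r q) = rounding r p"
proof (rule multiset_eqI)
  fix y
  have finp: "finite (set_pmf p)" using q p by auto
  have N0: "0 < N" using N by simp
  let ?F = "{x \<in> set_pmf q. f x = y}"
  have "count (image_mset f (rounding r q)) y = (\<Sum>x\<in>?F. count (rounding r q) x)"
    unfolding count_image_mset using set_mset_rounding[OF q, of r] q
    by (intro sum.mono_neutral_left) (auto simp: not_in_iff)
  then have "real (count (image_mset f (rounding r q)) y) = (\<Sum>x\<in>?F. real (count (rounding r q) x))"
    by simp
  moreover have "real n * pmf p y = (\<Sum>x\<in>?F. real n * pmf q x)"
    using pmf_map_eq_sum[OF q order_refl, of f y] p by (simp add: sum_distrib_left)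
  ultimately have "\<bar>real n * pmf p y - real (count (image_mset f (rounding r q)) y)\<bar> =
    \<bar>\<Sum>x\<in>?F. real n * pmf q x - real (count (rounding r q) x)\<bar>"
    by (simp add: sum_subtractf)
  also have "\<dots> \<le> (\<Sum>x\<in>?F. \<bar>real n * pmf q x - real (count (rounding r q) x)\<bar>)"
    by (rule sum_abs)
  also have "\<dots> \<le> (\<Sum>x\<in>?F. 1 / real N)"
    using count_rounding_approx[where p = q and r = r, OF q N0 rq] by (intro sum_mono less_imp_le)
  also have "\<dots> \<le> real (card (set_pmf q)) / real N"
    using q card_mono[of "set_pmf q" ?F] by (simp add: divide_right_mono)
  finally have "\<bar>real n * pmf p y - real (count (image_mset f (rounding r q)) y)\<bar> \<le>
    real (card (set_pmf q)) / real N" .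
  moreover have "\<bar>real n * pmf p y - real (count (rounding r p) y)\<bar> < 1 / real N"
    using count_rounding_approx[where p = p and r = r, OF finp N0 rp] .
  moreover have "real (card (set_pmf q)) / real N + 1 / real N \<le> 1"
    using N N0 by (simp add: add_divide_distrib[symmetric])
  ultimately have "\<bar>real (count (image_mset f (rounding r q)) y) - real (count (rounding r p) y)\<bar> < 1"
    by linarith \<comment> \<open>and both counts are integers\<close>
  then show "count (image_mset f (rounding r q)) y = count (rounding r p) y" by linarith
qed

text \<open>The rounded weights sum to \<open>n\<close> up to an error below one, hence
  exactly.\<close>

lemma size_rounding:
  assumes p: "finite (set_pmf p)" and N: "card (set_pmf p) + 1 \<le> N"
    and r: "\<And>x. x \<in> set_pmf p \<Longrightarrow> \<bar>real n * pmf p x - of_int (r (pmf p x))\<bar> < 1 / real N"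
  shows "size (rounding r p) = n"
proof -
  have N0: "0 < N" using N by simp
  have "size (rounding r p) = (\<Sum>x\<in>set_pmf p. count (rounding r p) x)"
    unfolding size_multiset_overloaded_eq using set_mset_rounding[OF p, of r] p
    by (intro sum.mono_neutral_left) (auto simp: not_in_iff)
  then have "real (size (rounding r p)) = (\<Sum>x\<in>set_pmf p. real (count (rounding r p) x))" by simp
  moreover have "real n = (\<Sum>x\<in>set_pmf p. real n * pmf p x)"
    using sum_pmf_eq_1[OF p order_refl] by (simp add: sum_distrib_left[symmetric])
  ultimately have "\<bar>real n - real (size (rounding r p))\<bar> =
    \<bar>\<Sum>x\<in>set_pmf p. real n * pmf p x - real (count (rounding r p) x)\<bar>"
    by (simp add: sum_subtractf)
  also have "\<dots> \<le> (\<Sum>x\<in>set_pmf p. \<bar>real n * pmf p x - real (count (rounding r p) x)\<bar>)"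
    by (rule sum_abs)
  also have "\<dots> \<le> (\<Sum>x\<in>set_pmf p. 1 / real N)"
    using count_rounding_approx[where p = p and r = r, OF p N0 r] by (intro sum_mono less_imp_le)
  also have "\<dots> < 1" using N N0 by simp
  finally show ?thesis by linarith
qed

lemma pmf_rounding_approx:
  assumes p: "finite (set_pmf p)" and N: "card (set_pmf p) + 1 \<le> N" and n: "0 < n"
    and r: "\<And>x. x \<in> set_pmf p \<Longrightarrow> \<bar>real n * pmf p x - of_int (r (pmf p x))\<bar> < 1 / real N"
  shows "\<bar>pmf (pmf_of_multiset (rounding r p)) x - pmf p x\<bar> \<le> 1 / real N"
proof -
  have N0: "0 < N" using N by simp
  note size = size_rounding[where p = p and r = r, OF p N r]
  have "rounding r p \<noteq> {#}" using size n by auto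
  then have "pmf (pmf_of_multiset (rounding r p)) x - pmf p x =
     (real (count (rounding r p) x) - real n * pmf p x) / real n"
    using n size by (simp add: field_simps)
  then have "\<bar>pmf (pmf_of_multiset (rounding r p)) x - pmf p x\<bar> =
     \<bar>real n * pmf p x - real (count (rounding r p) x)\<bar> / real n"
    by (simp add: abs_minus_commute)
  also have "\<dots> \<le> \<bar>real n * pmf p x - real (count (rounding r p) x)\<bar> / 1"
    using n by (intro divide_left_mono) auto
  also have "\<dots> \<le> 1 / real N"
    using count_rounding_approx[where p = p and r = r, OF p N0 r] by (simp add: less_imp_le)
  finally show ?thesis .
qed

text \<open>A single denominator and a single rounding function serve \<open>law X\<close> and all
  the \<open>q H\<close>. All edge marginals of the rounded \<open>q H\<close> therefore equal the
  same multiset, the rounding of \<open>law X\<close>.\<close>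

lemma simultaneous_types:
  assumes X: "X \<in> finite_joint_dists" and \<H>: "finite \<H>" "\<H> \<subseteq> M2"
    and q: "\<And>H. H \<in> \<H> \<Longrightarrow> q H \<in> Q H X"
  obtains M T where "Suc k \<le> size M" "set_mset M \<subseteq> set_pmf (law X)"
    "\<And>z. \<bar>pmf (pmf_of_multiset M) z - pmf (law X) z\<bar> \<le> 1 / real (Suc k)"
    "\<And>H. H \<in> \<H> \<Longrightarrow> set_mset (T H) \<subseteq> set_pmf (q H)"
    "\<And>H. H \<in> \<H> \<Longrightarrow> size (T H) = size M"
    "\<And>H e. H \<in> \<H> \<Longrightarrow> e \<in> edges H \<Longrightarrow> image_mset (edge_value e) (T H) = M"
    "\<And>H \<omega>. H \<in> \<H> \<Longrightarrow> \<bar>pmf (pmf_of_multiset (T H)) \<omega> - pmf (q H) \<omega>\<bar> \<le> 1 / real (Suc k)"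
proof -
  have finX: "finite (set_pmf (law X))"
    using X by (auto simp: finite_joint_dists_def intro: finite_subset)
  have finq: "finite (set_pmf (q H))" if "H \<in> \<H>" for H
  proof -
    have "finite (assignments H (F1 X) (F2 X))"
      using X M2_D[of H] \<H>(2) that by (intro finite_assignments) (auto simp: finite_joint_dists_def)
    then show ?thesis using q[OF that] finite_subset by (auto simp: Q_iff)
  qed
  define S where "S = pmf (law X) ` set_pmf (law X) \<union> (\<Union>H\<in>\<H>. pmf (q H) ` set_pmf (q H))"
  \<comment> \<open>The summand \<open>Suc k\<close> gives the accuracy; with the support sizes
    added, \<open>N\<close> exceeds each support size by at least one, as exact rounding
    requires.\<close>
  define N where "N = Suc k + card (set_pmf (law X)) + (\<Sum>H\<in>\<H>. card (set_pmf (q H)))"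
  have "finite S" "0 < N" using finX finq \<H>(1) by (auto simp: S_def N_def)
  then obtain n r where n: "Suc k \<le> n"
    and r: "\<And>s. s \<in> S \<Longrightarrow> \<bar>real n * s - of_int (r s)\<bar> < 1 / real N"
    using simultaneous_approximation[of S N "Suc k"] by blast
  have rX: "\<And>z. z \<in> set_pmf (law X) \<Longrightarrow> \<bar>real n * pmf (law X) z - of_int (r (pmf (law X) z))\<bar> < 1 / real N"
    using r by (auto simp: S_def)
  have rq: "\<And>\<omega>. \<omega> \<in> set_pmf (q H) \<Longrightarrow> \<bar>real n * pmf (q H) \<omega> - of_int (r (pmf (q H) \<omega>))\<bar> < 1 / real N"
    if "H \<in> \<H>" for H
    using r that by (auto simp: S_def)
  have NX: "card (set_pmf (law X)) + 1 \<le> N" by (simp add: N_def)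
  have Nq: "card (set_pmf (q H)) + 1 \<le> N" if "H \<in> \<H>" for H
    using member_le_sum[of H \<H> "\<lambda>H. card (set_pmf (q H))"] that \<H>(1) by (simp add: N_def)
  have "Suc k \<le> N" by (simp add: N_def)
  then have Nk: "1 / real N \<le> 1 / real (Suc k)" by (intro frac_le) simp_all
  have n0: "0 < n" using n by simp
  show thesis
  proof (rule that[of "rounding r (law X)" "\<lambda>H. rounding r (q H)"])
    have sizeX: "size (rounding r (law X)) = n" by (rule size_rounding[OF finX NX rX])
    then show "Suc k \<le> size (rounding r (law X))" using n by simp
    show "set_mset (rounding r (law X)) \<subseteq> set_pmf (law X)" by (rule set_mset_rounding[OF finX])
    show "\<bar>pmf (pmf_of_multiset (rounding r (law X))) z - pmf (law X) z\<bar> \<le> 1 / real (Suc k)" for z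
      using pmf_rounding_approx[where r = r, OF finX NX n0 rX] Nk by (rule order_trans)
    fix H assume H: "H \<in> \<H>"
    show "set_mset (rounding r (q H)) \<subseteq> set_pmf (q H)" by (rule set_mset_rounding[OF finq[OF H]])
    show "size (rounding r (q H)) = size (rounding r (law X))"
      using size_rounding[where r = r, OF finq[OF H] Nq[OF H] rq[OF H]] sizeX by simp
    show "\<bar>pmf (pmf_of_multiset (rounding r (q H))) \<omega> - pmf (q H) \<omega>\<bar> \<le> 1 / real (Suc k)" for \<omega>
      using pmf_rounding_approx[where r = r, OF finq[OF H] Nq[OF H] n0 rq[OF H]] Nk by (rule order_trans)
    fix e assume "e \<in> edges H"
    then have "map_pmf (edge_value e) (q H) = law X" using q[OF H] by (simp add: Q_iff)
    then show "image_mset (edge_value e) (rounding r (q H)) = rounding r (law X)"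
      by (rule image_mset_rounding[OF finq[OF H] Nq[OF H] _ rq[OF H] rX])
  qed
qed

lemma map_pmf_of_multiset:
  assumes "M \<noteq> {#}"
  shows "map_pmf f (pmf_of_multiset M) = pmf_of_multiset (image_mset f M)"
proof (rule pmf_eqI)
  fix y
  have "pmf (map_pmf f (pmf_of_multiset M)) y = (\<Sum>x\<in>{x \<in> set_mset M. f x = y}. real (count M x)) / real (size M)"
    using assms by (simp add: pmf_map_eq_sum[of "set_mset M"] sum_divide_distrib)
  also have "{x \<in> set_mset M. f x = y} = f -` {y} \<inter> set_mset M" by auto
  finally show "pmf (map_pmf f (pmf_of_multiset M)) y = pmf (pmf_of_multiset (image_mset f M)) y"
    using assms by (simp add: count_image_mset)
qed

section \<open>Compactness of the set of couplings\<close>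

text \<open>One sample of \<open>X\<close> is copied to all vertices: its first value to every
  vertex of \<open>V1 H\<close>, its second to every vertex of \<open>V2 H\<close>.\<close>

lemma Q_nonempty:
  assumes H: "H \<in> M2" and X: "X \<in> finite_joint_dists"
  shows "Q H X \<noteq> {}"
proof -
  define \<phi> where "\<phi> z = (\<lambda>x\<in>V1 H <+> V2 H. case x of Inl _ \<Rightarrow> fst z | Inr _ \<Rightarrow> snd z)"
    for z :: "nat \<times> nat"
  have "map_pmf (edge_value e) (map_pmf \<phi> (law X)) = law X" if "e \<in> edges H" for e
  proof -
    have "fst e \<in> V1 H" "snd e \<in> V2 H" using that M2_D(3)[OF H] by auto
    then have "edge_value e \<circ> \<phi> = id"
      by (auto simp: fun_eq_iff edge_value_def \<phi>_def)
    then show ?thesis by (simp add: pmf.map_comp)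
  qed
  moreover have "\<phi> z \<in> assignments H (F1 X) (F2 X)" if "z \<in> set_pmf (law X)" for z
    using that X by (auto simp: \<phi>_def assignments_iff finite_joint_dists_def)
  ultimately have "map_pmf \<phi> (law X) \<in> Q H X" by (auto simp: Q_iff)
  then show ?thesis by blast
qed

text \<open>Edge marginals and entropy are continuous in the weights. The \<open>q j\<close> may lie
  outside \<open>Q H X\<close>; it is enough that their common edge marginals converge to
  \<open>law X\<close>, as happens for empirical distributions of types.\<close>

lemma Q_subsequence_limit:
  assumes H: "H \<in> M2" and X: "X \<in> finite_joint_dists"
    and q: "\<And>j. set_pmf (q j) \<subseteq> assignments H (F1 X) (F2 X)"
    and p: "\<And>j e. e \<in> edges H \<Longrightarrow> map_pmf (edge_value e) (q j) = p j"
    and lim: "\<And>z. (\<lambda>j::nat. pmf (p j) z) \<longlonglongrightarrow> pmf (law X) z"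
  obtains s q' where "strict_mono (s :: nat \<Rightarrow> nat)" "q' \<in> Q H X"
    "(\<lambda>j. shannon_entropy (q (s j))) \<longlonglongrightarrow> shannon_entropy q'"
proof -
  let ?\<Omega> = "assignments H (F1 X) (F2 X)"
  have fin: "finite ?\<Omega>"
    using M2_D[OF H] X by (intro finite_assignments) (auto simp: finite_joint_dists_def)
  obtain s q' where s: "strict_mono (s :: nat \<Rightarrow> nat)" and q': "set_pmf q' \<subseteq> ?\<Omega>"
    and lim': "\<And>\<omega>. \<omega> \<in> ?\<Omega> \<Longrightarrow> (\<lambda>j. pmf (q (s j)) \<omega>) \<longlonglongrightarrow> pmf q' \<omega>"
    by (rule pmf_convergent_subsequence[of _ q, OF fin q]) (rule that)
  have "map_pmf (edge_value e) q' = law X" if "e \<in> edges H" for e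
  proof (rule pmf_eqI)
    fix z
    have "(\<lambda>j. pmf (map_pmf (edge_value e) (q (s j))) z) \<longlonglongrightarrow> pmf (map_pmf (edge_value e) q') z"
      by (rule tendsto_pmf_map[OF fin q q' lim'])
    then have "(\<lambda>j. pmf (p (s j)) z) \<longlonglongrightarrow> pmf (map_pmf (edge_value e) q') z"
      by (simp only: p[OF that])
    moreover have "(\<lambda>j. pmf (p (s j)) z) \<longlonglongrightarrow> pmf (law X) z"
      using LIMSEQ_subseq_LIMSEQ[OF lim s] by (simp add: o_def)
    ultimately show "pmf (map_pmf (edge_value e) q') z = pmf (law X) z" by (rule LIMSEQ_unique)
  qed
  then have "q' \<in> Q H X" using q' by (simp add: Q_iff)
  moreover have "(\<lambda>j. shannon_entropy (q (s j))) \<longlonglongrightarrow> shannon_entropy q'"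
    by (rule tendsto_shannon_entropy[OF fin q q' lim'])
  ultimately show thesis using that s by blast
qed

lemma entropy_le_m:
  assumes "H \<in> M2" "X \<in> finite_joint_dists" "q \<in> Q H X"
  shows "shannon_entropy q \<le> m H X"
  unfolding m_def using assms by (intro cSUP_upper bdd_above_entropy_Q)

text \<open>A maximising sequence has a limit point in \<open>Q H X\<close>, here with constant edge
  marginals.\<close>

lemma m_attained:
  assumes H: "H \<in> M2" and X: "X \<in> finite_joint_dists"
  obtains q where "q \<in> Q H X" "shannon_entropy q = m H X"
proof -
  have "\<exists>q\<in>Q H X. m H X - 1 / real (Suc j) < shannon_entropy q" for j
    using less_cSUP_iff[OF Q_nonempty[OF H X] bdd_above_entropy_Q[OF H X], of "m H X - 1 / real (Suc j)"]
    by (simp add: m_def)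
  then obtain q where q: "\<And>j. q j \<in> Q H X" "\<And>j. m H X - 1 / real (Suc j) < shannon_entropy (q j)"
    by metis
  obtain s q' where s: "strict_mono (s :: nat \<Rightarrow> nat)" and q': "q' \<in> Q H X"
    and lim: "(\<lambda>j. shannon_entropy (q (s j))) \<longlonglongrightarrow> shannon_entropy q'"
    by (rule Q_subsequence_limit[OF H X, of q "\<lambda>_. law X"]) (use q(1) in \<open>auto simp: Q_iff\<close>)
  have "(\<lambda>j. m H X - 1 / real (Suc (s j))) \<longlonglongrightarrow> m H X - 0"
    using LIMSEQ_subseq_LIMSEQ[OF LIMSEQ_inverse_real_of_nat s]
    by (intro tendsto_intros) (simp add: o_def inverse_eq_divide)
  then have "m H X - 0 \<le> shannon_entropy q'"
    using lim by (rule LIMSEQ_le) (use q(2) less_imp_le in blast)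
  then show thesis using that[OF q'] entropy_le_m[OF H X q'] by simp
qed

text \<open>Otherwise some subsequence keeps entropy at least \<open>m H X + \<epsilon>\<close>, and
  so does its limit point in \<open>Q H X\<close>, against maximality.\<close>

lemma eventually_entropy_less:
  assumes H: "H \<in> M2" and X: "X \<in> finite_joint_dists"
    and q: "\<And>j. set_pmf (q j) \<subseteq> assignments H (F1 X) (F2 X)"
    and p: "\<And>j e. e \<in> edges H \<Longrightarrow> map_pmf (edge_value e) (q j) = p j"
    and lim: "\<And>z. (\<lambda>j::nat. pmf (p j) z) \<longlonglongrightarrow> pmf (law X) z"
    and \<epsilon>: "0 < \<epsilon>"
  shows "\<forall>\<^sub>F j in sequentially. shannon_entropy (q j) < m H X + \<epsilon>"
proof (rule ccontr)
  assume "\<not> ?thesis"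
  then obtain r where r: "strict_mono (r :: nat \<Rightarrow> nat)" "\<And>j. m H X + \<epsilon> \<le> shannon_entropy (q (r j))"
    using not_eventually_sequentiallyD by (metis not_less)
  obtain s q' where "q' \<in> Q H X" "(\<lambda>j. shannon_entropy (q (r (s j)))) \<longlonglongrightarrow> shannon_entropy q'"
    by (rule Q_subsequence_limit[OF H X, of "\<lambda>j. q (r j)" "\<lambda>j. p (r j)"])
       (use q p LIMSEQ_subseq_LIMSEQ[OF lim r(1)] in \<open>auto simp: o_def\<close>)
  then have "m H X + \<epsilon> \<le> shannon_entropy q'"
    using r(2) by (intro LIMSEQ_le_const) auto
  then show False using entropy_le_m[OF H X \<open>q' \<in> Q H X\<close>] \<epsilon> by simp
qed

section \<open>Asymptotics of homomorphism numbers\<close>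

text \<open>The term with \<open>a\<close> will account for the number of types, the term with
  \<open>b\<close> for the Stirling error; both are negligible against \<open>n k\<close>, which
  tends to infinity.\<close>

lemma ln_error_tendsto_0:
  fixes n :: "nat \<Rightarrow> nat" and a b :: real
  assumes "\<And>k. Suc k \<le> n k"
  shows "(\<lambda>k. (a * ln (real (n k) + 1) + b * (ln (real (n k)) + 1)) / real (n k)) \<longlonglongrightarrow> 0"
proof -
  have "((\<lambda>x::real. (a * ln (x + 1) + b * (ln x + 1)) / x) \<longlongrightarrow> 0) at_top" by real_asymp
  moreover have "filterlim n at_top sequentially"
    by (rule filterlim_at_top_mono[OF filterlim_ident]) (simp add: assms Suc_leD always_eventually)
  then have "filterlim (\<lambda>k. real (n k)) at_top sequentially"
    by (rule filterlim_compose[OF filterlim_real_sequentially])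
  ultimately show ?thesis by (rule filterlim_compose)
qed

lemma ln_card_permutations_tendsto:
  fixes n :: "nat \<Rightarrow> nat"
  assumes A: "finite A" and S: "\<And>k. set_mset (S k) \<subseteq> A" "\<And>k. size (S k) = n k"
    and n: "\<And>k. Suc k \<le> n k"
    and lim: "(\<lambda>k. shannon_entropy (pmf_of_multiset (S k))) \<longlonglongrightarrow> L"
  shows "(\<lambda>k. ln (real (card (permutations_of_multiset (S k)))) / real (n k)) \<longlonglongrightarrow> L"
proof (rule Lim_transform[OF lim])
  \<comment> \<open>The coefficient 0 brings the error into the shape of
    \<open>ln_error_tendsto_0\<close>.\<close>
  let ?e = "\<lambda>k. (0 * ln (real (n k) + 1) + (real (card A) + 1) * (ln (real (n k)) + 1)) / real (n k)"
  have "\<bar>ln (real (card (permutations_of_multiset (S k)))) / real (n k) - shannon_entropy (pmf_of_multiset (S k))\<bar> \<le> ?e k"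
    for k
  proof -
    have n0: "0 < n k" using n[of k] by simp
    then have "S k \<noteq> {#}" using S(2)[of k] by auto
    have "ln (real (card (permutations_of_multiset (S k)))) / real (n k) - shannon_entropy (pmf_of_multiset (S k)) =
      (ln (real (card (permutations_of_multiset (S k)))) - real (n k) * shannon_entropy (pmf_of_multiset (S k))) / real (n k)"
      using n0 by (simp add: field_simps)
    then show ?thesis
      using ln_card_permutations_of_multiset[OF A S(1) \<open>S k \<noteq> {#}\<close>] n0
      by (simp add: S(2) abs_divide divide_right_mono)
  qed
  then have "\<forall>\<^sub>F k in sequentially. norm (ln (real (card (permutations_of_multiset (S k)))) / real (n k) -
      shannon_entropy (pmf_of_multiset (S k))) \<le> ?e k"
    by (intro always_eventually) simp
  from Lim_null_comparison[OF this ln_error_tendsto_0[OF n]]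
  show "(\<lambda>k. ln (real (card (permutations_of_multiset (S k)))) / real (n k) -
      shannon_entropy (pmf_of_multiset (S k))) \<longlonglongrightarrow> 0" .
qed

text \<open>The given types \<open>T k\<close> approximate an optimal \<open>q\<close> and bound the
  count from below. For the upper bound the largest type classes suffice: their edge marginals
  converge to \<open>law X\<close>, so compactness bounds their entropy asymptotically by
  \<open>m H X\<close>.\<close>

lemma ln_card_homs_tendsto:
  assumes H: "H \<in> M2" and X: "X \<in> finite_joint_dists"
    and M: "\<And>k. Suc k \<le> size (M k)" "\<And>k. set_mset (M k) \<subseteq> set_pmf (law X)"
      "\<And>z. (\<lambda>k. pmf (pmf_of_multiset (M k)) z) \<longlonglongrightarrow> pmf (law X) z"
    and q: "q \<in> Q H X" "shannon_entropy q = m H X"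
    and T: "\<And>k. set_mset (T k) \<subseteq> set_pmf q" "\<And>k. size (T k) = size (M k)"
      "\<And>k e. e \<in> edges H \<Longrightarrow> image_mset (edge_value e) (T k) = M k"
      "\<And>\<omega>. (\<lambda>k. pmf (pmf_of_multiset (T k)) \<omega>) \<longlonglongrightarrow> pmf q \<omega>"
  shows "(\<lambda>k. ln (real (card (homs H (type_graph (M k))))) / real (size (M k))) \<longlonglongrightarrow> m H X"
proof -
  note H' = M2_D[OF H]
  let ?\<Omega> = "assignments H (F1 X) (F2 X)"
  define n where "n k = size (M k)" for k
  define c where "c = card ?\<Omega>"
  have FX: "finite (F1 X)" "finite (F2 X)" "set_pmf (law X) \<subseteq> F1 X \<times> F2 X"
    using X by (auto simp: finite_joint_dists_def)
  have fin: "finite ?\<Omega>" using H' FX by (intro finite_assignments)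
  have n: "Suc k \<le> n k" for k using M(1) by (simp add: n_def)
  have MX: "set_mset (M k) \<subseteq> F1 X \<times> F2 X" for k using M(2) FX(3) by blast
  have q\<Omega>: "set_pmf q \<subseteq> ?\<Omega>" using q(1) by (simp add: Q_iff)
  note bounds = card_homs_type_graph_bounds[OF H FX(1,2) MX]
  let ?a = "\<lambda>k. ln (real (card (homs H (type_graph (M k)))))"
  have ne: "T k \<noteq> {#}" for k using T(2)[of k] M(1)[of k] by auto
  have "(\<lambda>k. shannon_entropy (pmf_of_multiset (T k))) \<longlonglongrightarrow> m H X"
    unfolding q(2)[symmetric] using ne T q\<Omega>
    by (intro tendsto_shannon_entropy[OF fin]) (simp_all add: order_trans[OF T(1)])
  then have lower: "(\<lambda>k. ln (real (card (permutations_of_multiset (T k)))) / real (n k)) \<longlonglongrightarrow> m H X"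
    using T(2) n by (intro ln_card_permutations_tendsto[OF fin order_trans[OF T(1) q\<Omega>]]) (simp_all add: n_def)
  have lower_le: "ln (real (card (permutations_of_multiset (T k)))) / real (n k) \<le> ?a k / real (n k)" for k
  proof -
    have "card (permutations_of_multiset (T k)) \<le> card (homs H (type_graph (M k)))"
      using T q\<Omega> by (intro bounds(1)) blast
    moreover have "0 < card (permutations_of_multiset (T k))" by (simp add: card_gt_0_iff)
    ultimately have "ln (real (card (permutations_of_multiset (T k)))) \<le> ?a k" by simp
    then show ?thesis by (intro divide_right_mono) auto
  qed
  have "\<exists>S. set_mset S \<subseteq> ?\<Omega> \<and> (\<forall>e\<in>edges H. image_mset (edge_value e) S = M k) \<and>
      card (homs H (type_graph (M k))) \<le> (n k + 1) ^ c * card (permutations_of_multiset S)" for k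
    using bounds(2)[of k] by (auto simp: n_def c_def)
  then obtain S where S: "\<And>k. set_mset (S k) \<subseteq> ?\<Omega>"
      "\<And>k e. e \<in> edges H \<Longrightarrow> image_mset (edge_value e) (S k) = M k"
      "\<And>k. card (homs H (type_graph (M k))) \<le> (n k + 1) ^ c * card (permutations_of_multiset (S k))"
    by metis
  obtain e0 where e0: "e0 \<in> edges H" using H'(4) by auto
  have sizeS: "size (S k) = n k" for k
    using arg_cong[OF S(2)[OF e0], of size k] by (simp add: n_def)
  have neS: "S k \<noteq> {#}" for k using sizeS[of k] n[of k] by auto
  \<comment> \<open>The first logarithmic term bounds the number of types, the second the deviation
    of one type class from its entropy.\<close>
  have upper_le: "?a k / real (n k) \<le> shannon_entropy (pmf_of_multiset (S k)) +
      (real c * ln (real (n k) + 1) + (real c + 1) * (ln (real (n k)) + 1)) / real (n k)" for k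
  proof -
    have n0: "0 < n k" using n[of k] by simp
    have pos: "0 < card (permutations_of_multiset (S k))" by (simp add: card_gt_0_iff)
    have "0 < card (homs H (type_graph (M k)))"
      using homs_nonempty[OF type_graph_in_bigraphs0 H'(3)] finite_homs[OF H'(1,2)]
        bigraphs0_D[OF type_graph_in_bigraphs0] by (simp add: card_gt_0_iff)
    then have "?a k \<le> ln (real ((n k + 1) ^ c * card (permutations_of_multiset (S k))))"
      using S(3)[of k] by (subst ln_le_cancel_iff) (auto simp: pos simp flip: of_nat_mult of_nat_power)
    also have "\<dots> = real c * ln (real (n k) + 1) + ln (real (card (permutations_of_multiset (S k))))"
      using pos by (simp add: ln_mult ln_realpow add.commute)
    also have "ln (real (card (permutations_of_multiset (S k)))) \<le>
        real (n k) * shannon_entropy (pmf_of_multiset (S k)) + (real c + 1) * (ln (real (n k)) + 1)"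
      using ln_card_permutations_of_multiset[OF fin S(1) neS, of k] by (simp add: sizeS c_def)
    finally show ?thesis using n0 by (simp add: field_simps)
  qed
  have "(\<lambda>k. ?a k / real (n k)) \<longlonglongrightarrow> m H X"
  proof (rule order_tendstoI)
    fix x assume "x < m H X"
    with lower have "\<forall>\<^sub>F k in sequentially. x < ln (real (card (permutations_of_multiset (T k)))) / real (n k)"
      by (rule order_tendstoD)
    then show "\<forall>\<^sub>F k in sequentially. x < ?a k / real (n k)"
      by (rule eventually_mono) (use lower_le less_le_trans in blast)
  next
    fix x assume x: "m H X < x"
    \<comment> \<open>Half of the gap is allotted to the entropy and half to the logarithmic
      errors.\<close>
    define \<epsilon> where "\<epsilon> = (x - m H X) / 2"
    have \<epsilon>: "0 < \<epsilon>" using x by (simp add: \<epsilon>_def)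
    have "\<forall>\<^sub>F k in sequentially. shannon_entropy (pmf_of_multiset (S k)) < m H X + \<epsilon>"
    proof (rule eventually_entropy_less[OF H X, where p = "\<lambda>k. pmf_of_multiset (M k)"])
      show "set_pmf (pmf_of_multiset (S k)) \<subseteq> ?\<Omega>" for k using S(1) neS by simp
      show "map_pmf (edge_value e) (pmf_of_multiset (S k)) = pmf_of_multiset (M k)"
        if e: "e \<in> edges H" for k e
        unfolding map_pmf_of_multiset[OF neS] S(2)[OF e] ..
    qed (use M(3) \<epsilon> in auto)
    moreover have "\<forall>\<^sub>F k in sequentially.
        (real c * ln (real (n k) + 1) + (real c + 1) * (ln (real (n k)) + 1)) / real (n k) < \<epsilon>"
      using ln_error_tendsto_0[OF n] \<epsilon> by (rule order_tendstoD)
    ultimately show "\<forall>\<^sub>F k in sequentially. ?a k / real (n k) < x"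
    proof eventually_elim
      case (elim k)
      moreover have "x = m H X + \<epsilon> + \<epsilon>" by (simp add: \<epsilon>_def)
      ultimately show ?case using upper_le[of k] by linarith
    qed
  qed
  then show ?thesis by (simp add: n_def)
qed

text \<open>Each vertex class is a single type class, that of a marginal of \<open>M k\<close>, and
  its empirical distribution converges to the matching marginal of \<open>law X\<close>.\<close>

lemma ln_card_V_tendsto:
  assumes X: "X \<in> finite_joint_dists"
    and M: "\<And>k. Suc k \<le> size (M k)" "\<And>k. set_mset (M k) \<subseteq> set_pmf (law X)"
      "\<And>z. (\<lambda>k. pmf (pmf_of_multiset (M k)) z) \<longlonglongrightarrow> pmf (law X) z"
  shows "(\<lambda>k. ln (real (card (V1 (type_graph (M k))))) / real (size (M k))) \<longlonglongrightarrow> shannon_entropy (law1 X)"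
    and "(\<lambda>k. ln (real (card (V2 (type_graph (M k))))) / real (size (M k))) \<longlonglongrightarrow> shannon_entropy (law2 X)"
proof -
  have fin: "finite (set_pmf (law X))"
    using X by (auto simp: finite_joint_dists_def intro: finite_subset)
  have ne: "M k \<noteq> {#}" for k using M(1)[of k] by auto
  have *: "(\<lambda>k. ln (real (card (permutations_of_multiset (image_mset f (M k))))) / real (size (M k)))
      \<longlonglongrightarrow> shannon_entropy (map_pmf f (law X))" for f :: "nat \<times> nat \<Rightarrow> nat"
  proof (rule ln_card_permutations_tendsto)
    show "finite (f ` set_pmf (law X))" using fin by simp
    show "set_mset (image_mset f (M k)) \<subseteq> f ` set_pmf (law X)" for k using M(2)[of k] by auto
    have "(\<lambda>k. shannon_entropy (map_pmf f (pmf_of_multiset (M k)))) \<longlonglongrightarrow> shannon_entropy (map_pmf f (law X))"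
    proof (rule tendsto_shannon_entropy[of "f ` set_pmf (law X)"])
      fix y
      show "(\<lambda>k. pmf (map_pmf f (pmf_of_multiset (M k))) y) \<longlonglongrightarrow> pmf (map_pmf f (law X)) y"
        using M ne by (intro tendsto_pmf_map[OF fin]) auto
    qed (use fin M ne in \<open>auto dest!: subsetD\<close>)
    then show "(\<lambda>k. shannon_entropy (pmf_of_multiset (image_mset f (M k)))) \<longlonglongrightarrow> shannon_entropy (map_pmf f (law X))"
      by (simp only: map_pmf_of_multiset[OF ne])
  qed (use M(1) in auto)
  show "(\<lambda>k. ln (real (card (V1 (type_graph (M k))))) / real (size (M k))) \<longlonglongrightarrow> shannon_entropy (law1 X)"
    "(\<lambda>k. ln (real (card (V2 (type_graph (M k))))) / real (size (M k))) \<longlonglongrightarrow> shannon_entropy (law2 X)"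
    unfolding card_V_type_graph by (rule *)+
qed

text \<open>Used contrapositively: a nonzero \<open>d P1 G\<close> shows that \<open>h\<close> is
  given by the quotient. The count of homomorphisms from \<open>P1\<close> comes from evaluating
  \<open>m P1 (edge_law G)\<close> in two ways.\<close>

lemma d_P1_complete:
  assumes G: "G \<in> bigraphs0" and trans: "edge_vertex_transitive G" and "edges G = V1 G \<times> V2 G"
  shows "d P1 G = 0"
proof -
  note G' = bigraphs0_D[OF G]
  have pos: "0 < card (V1 G)" "0 < card (V2 G)" using G' by (auto simp: card_gt_0_iff)
  have "ln (real (card (homs P1 G))) = shannon_entropy (pmf_of_set (edges G))"
    using m_edge_law[OF G trans P1_in_M2] m_P1[OF edge_law_in_finite_joint_dists[OF G]]
    by (simp add: edge_law_def)
  also have "\<dots> = ln (real (card (edges G)))" using G' by (intro shannon_entropy_pmf_of_set)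
  also have "\<dots> = ln (real (card (V1 G))) + ln (real (card (V2 G)))"
    using pos assms(3) by (simp add: card_cartesian_product ln_mult)
  finally show ?thesis
    using d_eq_homs[OF G P1_in_M2] by (simp add: P1_def)
qed

section \<open>Approximating a joint distribution by transitive graphs\<close>

lemma transitive_approximation:
  assumes X: "X \<in> finite_joint_dists" and \<H>: "finite \<H>" "\<H> \<subseteq> M2" and \<epsilon>: "0 < \<epsilon>"
  obtains G where "G \<in> bigraphs0" "edge_vertex_transitive G"
    "\<And>H. H \<in> \<H> \<Longrightarrow> \<bar>h H G - hstar H X\<bar> < \<epsilon>"
proof (cases "independent X")
  case True
  \<comment> \<open>The single edge is a complete graph, so both quantities take their conventional
    value, the number of edges of \<open>H\<close>.\<close>
  then have "h H P1 = hstar H X" for H by (simp add: h_def hstar_def P1_def)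
  then show ?thesis using that[OF P1_transitive(2,1)] \<epsilon> by simp
next
  case False
  \<comment> \<open>\<open>P1\<close> is included because the denominators of \<open>h\<close> and
    \<open>hstar\<close> must be controlled on the same type graphs.\<close>
  define \<H>' where "\<H>' = insert P1 \<H>"
  have \<H>': "finite \<H>'" "\<H>' \<subseteq> M2" using \<H> P1_in_M2 by (auto simp: \<H>'_def)
  have "\<forall>H\<in>\<H>'. \<exists>q. q \<in> Q H X \<and> shannon_entropy q = m H X"
    using m_attained[OF _ X] \<H>'(2) by (metis subsetD)
  then obtain q where q: "\<And>H. H \<in> \<H>' \<Longrightarrow> q H \<in> Q H X" "\<And>H. H \<in> \<H>' \<Longrightarrow> shannon_entropy (q H) = m H X"
    by metis
  have "\<exists>M T. Suc k \<le> size M \<and> set_mset M \<subseteq> set_pmf (law X) \<and>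
    (\<forall>z. \<bar>pmf (pmf_of_multiset M) z - pmf (law X) z\<bar> \<le> 1 / real (Suc k)) \<and>
    (\<forall>H\<in>\<H>'. set_mset (T H) \<subseteq> set_pmf (q H) \<and> size (T H) = size M \<and>
      (\<forall>e\<in>edges H. image_mset (edge_value e) (T H) = M) \<and>
      (\<forall>\<omega>. \<bar>pmf (pmf_of_multiset (T H)) \<omega> - pmf (q H) \<omega>\<bar> \<le> 1 / real (Suc k)))" for k
    by (rule simultaneous_types[OF X \<H>' q(1), of k]) (assumption, blast)
  then obtain M T where M: "\<And>k. Suc k \<le> size (M k)" "\<And>k. set_mset (M k) \<subseteq> set_pmf (law X)"
      "\<And>k z. \<bar>pmf (pmf_of_multiset (M k)) z - pmf (law X) z\<bar> \<le> 1 / real (Suc k)"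
    and T: "\<And>k H. H \<in> \<H>' \<Longrightarrow> set_mset (T k H) \<subseteq> set_pmf (q H)"
      "\<And>k H. H \<in> \<H>' \<Longrightarrow> size (T k H) = size (M k)"
      "\<And>k H e. H \<in> \<H>' \<Longrightarrow> e \<in> edges H \<Longrightarrow> image_mset (edge_value e) (T k H) = M k"
      "\<And>k H \<omega>. H \<in> \<H>' \<Longrightarrow> \<bar>pmf (pmf_of_multiset (T k H)) \<omega> - pmf (q H) \<omega>\<bar> \<le> 1 / real (Suc k)"
    by metis
  have lim: "f \<longlonglongrightarrow> l" if "\<And>k. \<bar>f k - l\<bar> \<le> 1 / real (Suc k)" for f :: "nat \<Rightarrow> real" and l
  proof -
    have "(\<lambda>k. f k - l) \<longlonglongrightarrow> 0"
      by (rule Lim_null_comparison[OF _ LIMSEQ_inverse_real_of_nat])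
         (use that in \<open>auto simp: inverse_eq_divide\<close>)
    then show ?thesis by (simp add: LIM_zero_iff)
  qed
  note Mlim = lim[OF M(3)]
  define G where "G k = type_graph (M k)" for k
  define n where "n k = real (size (M k))" for k
  have n: "0 < n k" for k using M(1)[of k] by (simp add: n_def)
  have G: "G k \<in> bigraphs0" "edge_vertex_transitive (G k)" for k
    by (simp_all add: G_def type_graph_in_bigraphs0 type_graph_transitive)
  have dlim: "(\<lambda>k. d H (G k) / n k) \<longlonglongrightarrow> dstar H X" if H: "H \<in> \<H>'" for H
  proof -
    have HM: "H \<in> M2" using H \<H>'(2) by blast
    have "(\<lambda>k. ln (real (card (homs H (G k)))) / n k) \<longlonglongrightarrow> m H X"
      unfolding G_def n_def
      by (rule ln_card_homs_tendsto[OF HM X M(1,2) Mlim q[OF H] T(1-3)[OF H] lim[OF T(4)[OF H]]])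
    moreover have "(\<lambda>k. ln (real (card (V1 (G k)))) / n k) \<longlonglongrightarrow> shannon_entropy (law1 X)"
      "(\<lambda>k. ln (real (card (V2 (G k)))) / n k) \<longlonglongrightarrow> shannon_entropy (law2 X)"
      unfolding G_def n_def using ln_card_V_tendsto[OF X M(1,2) Mlim] .
    ultimately have "(\<lambda>k. - (ln (real (card (homs H (G k)))) / n k) +
        (real (card (V1 H)) * (ln (real (card (V1 (G k)))) / n k) +
         real (card (V2 H)) * (ln (real (card (V2 (G k)))) / n k))) \<longlonglongrightarrow> dstar H X"
      unfolding dstar_def by (intro tendsto_intros)
    then show ?thesis
      by (simp add: d_eq_homs[OF G(1) HM] add_divide_distrib diff_divide_distrib)
  qed
  have P1: "dstar P1 X \<noteq> 0" using dstar_P1_eq_0_imp_independent[OF X] False by blast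
  have "\<forall>\<^sub>F k in sequentially. \<bar>h H (G k) - hstar H X\<bar> < \<epsilon>" if H: "H \<in> \<H>" for H
  proof -
    \<comment> \<open>Normalising numerator and denominator by \<open>n k\<close> gives both a limit
      and leaves the quotient unchanged.\<close>
    have "(\<lambda>k. (d H (G k) / n k) / (d P1 (G k) / n k)) \<longlonglongrightarrow> dstar H X / dstar P1 X"
      using H P1 by (intro tendsto_divide dlim) (auto simp: \<H>'_def)
    then have "\<forall>\<^sub>F k in sequentially. dist ((d H (G k) / n k) / (d P1 (G k) / n k)) (dstar H X / dstar P1 X) < \<epsilon>"
      using \<epsilon> by (rule tendstoD)
    \<comment> \<open>The nonzero limit keeps the denominators nonzero from some index on, so these
      graphs are not complete.\<close>
    moreover have "\<forall>\<^sub>F k in sequentially. d P1 (G k) / n k \<noteq> 0"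
      using dlim[of P1] P1 by (intro tendsto_imp_eventually_ne) (auto simp: \<H>'_def)
    ultimately show ?thesis
    proof eventually_elim
      case (elim k)
      then have "edges (G k) \<noteq> V1 (G k) \<times> V2 (G k)"
        using d_P1_complete[OF G] by auto
      then show ?case
        using elim(1) n[of k] False by (simp add: h_def hstar_def dist_real_def)
    qed
  qed
  then have "\<forall>\<^sub>F k in sequentially. \<forall>H\<in>\<H>. \<bar>h H (G k) - hstar H X\<bar> < \<epsilon>"
    using \<H>(1) by (simp add: eventually_ball_finite)
  then obtain k where "\<forall>H\<in>\<H>. \<bar>h H (G k) - hstar H X\<bar> < \<epsilon>"
    by (auto dest: eventually_happens)
  then show thesis using that[OF G] by blast
qed

section \<open>The closure as a set of sequential limits\<close>

text \<open>Countability lets a single sequence of graphs approximate on an exhaustion of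
  \<open>M2\<close> by finite sets.\<close>

lemma countable_M2: "countable M2"
proof -
  have inj: "inj_on (\<lambda>G. (V1 G, V2 G, edges G)) bigraphs" by (auto simp: inj_on_def)
  have "(\<lambda>G. (V1 G, V2 G, edges G)) ` bigraphs \<subseteq>
      {A. finite A} \<times> {B. finite B} \<times> {E. finite E}"
    using finite_subset by (auto simp: bigraphs_def)
  moreover have "countable ({A::nat set. finite A} \<times> {B::nat set. finite B} \<times> {E::(nat \<times> nat) set. finite E})"
    by (intro countable_SIGMA countable_Collect_finite)
  ultimately have "countable ((\<lambda>G. (V1 G, V2 G, edges G)) ` bigraphs)" by (rule countable_subset)
  then have "countable bigraphs" using inj by (rule countable_image_inj_on)
  then show ?thesis
    by (rule countable_subset[rotated]) (auto simp: M2_def bigraphs0_def)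
qed

theorem theorem2:
  shows "product_topology (\<lambda>_. euclideanreal) M2 closure_of
           {\<lambda>H\<in>M2. h H G | G. G \<in> bigraphs0 \<and> edge_vertex_transitive G} = Lstar"
    (is "_ closure_of ?S = _")
proof -
  have ext: "?S \<subseteq> extensional M2" by auto
  show ?thesis
  proof (intro equalityI subsetI)
    fix f assume "f \<in> product_topology (\<lambda>_. euclideanreal) M2 closure_of ?S"
    then have f: "f \<in> extensional M2"
      and approx: "\<And>J \<epsilon>. finite J \<Longrightarrow> J \<subseteq> M2 \<Longrightarrow> 0 < \<epsilon> \<Longrightarrow> \<exists>g\<in>?S. \<forall>H\<in>J. \<bar>g H - f H\<bar> < \<epsilon>"
      unfolding in_closure_of_product_topology_real[OF ext] by auto
    have "M2 \<noteq> {}" using P1_in_M2 by blast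
    \<comment> \<open>The finite sets \<open>J i\<close> increase and exhaust \<open>M2\<close>; a
      graph that is accurate on \<open>J i\<close> up to \<open>1 / real (Suc i)\<close> serves as
      the \<open>i\<close>-th term.\<close>
    define J where "J i = from_nat_into M2 ` {..i}" for i
    have J: "finite (J i)" "J i \<subseteq> M2" for i
      using from_nat_into[OF \<open>M2 \<noteq> {}\<close>] by (auto simp: J_def)
    have "\<exists>G. G \<in> bigraphs0 \<and> edge_vertex_transitive G \<and> (\<forall>H\<in>J i. \<bar>h H G - f H\<bar> < 1 / real (Suc i))" for i
    proof -
      obtain g where g: "g \<in> ?S" "\<forall>H\<in>J i. \<bar>g H - f H\<bar> < 1 / real (Suc i)"
        using approx[OF J, of "1 / real (Suc i)" i] by auto
      then obtain G where "G \<in> bigraphs0" "edge_vertex_transitive G" "g = (\<lambda>H\<in>M2. h H G)" by blast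
      then show ?thesis using g(2) J(2)[of i] by (intro exI[of _ G]) (auto simp: subset_iff)
    qed
    then obtain G where G: "\<And>i. G i \<in> bigraphs0" "\<And>i. edge_vertex_transitive (G i)"
      "\<And>i H. H \<in> J i \<Longrightarrow> \<bar>h H (G i) - f H\<bar> < 1 / real (Suc i)"
      by metis
    have "(\<lambda>i. hstar H (edge_law (G i))) \<longlonglongrightarrow> f H" if H: "H \<in> M2" for H
    proof -
      have "(\<lambda>i. h H (G i) - f H) \<longlonglongrightarrow> 0"
      proof (rule Lim_null_comparison[OF _ LIMSEQ_inverse_real_of_nat])
        \<comment> \<open>Each \<open>H\<close> lies in all \<open>J i\<close> from its index in the
          enumeration on, which yields pointwise convergence.\<close>
        have "H \<in> J i" if "to_nat_on M2 H \<le> i" for i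
          using that H countable_M2 by (auto simp: J_def intro!: image_eqI[of _ _ "to_nat_on M2 H"])
        then show "\<forall>\<^sub>F i in sequentially. norm (h H (G i) - f H) \<le> inverse (real (Suc i))"
          using G(3) by (intro eventually_sequentiallyI[of "to_nat_on M2 H"])
            (simp add: inverse_eq_divide less_imp_le)
      qed
      then show ?thesis
        using hstar_edge_law[OF G(1,2) H] by (simp add: LIM_zero_iff)
    qed
    then show "f \<in> Lstar"
      using f edge_law_in_finite_joint_dists[OF G(1)]
      unfolding Lstar_def by (intro CollectI conjI exI[of _ "\<lambda>i. edge_law (G i)"]) auto
  next
    fix f assume "f \<in> Lstar"
    then obtain X where f: "f \<in> extensional M2" and X: "\<And>i::nat. X i \<in> finite_joint_dists"
      and lim: "\<And>H. H \<in> M2 \<Longrightarrow> (\<lambda>i. hstar H (X i)) \<longlonglongrightarrow> f H"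
      by (auto simp: Lstar_def)
    show "f \<in> product_topology (\<lambda>_. euclideanreal) M2 closure_of ?S"
      unfolding in_closure_of_product_topology_real[OF ext]
    proof (intro conjI allI impI)
      fix J and \<epsilon> :: real assume J: "finite J" "J \<subseteq> M2" and \<epsilon>: "0 < \<epsilon>"
      \<comment> \<open>Half of the tolerance goes to choosing one \<open>X i\<close> near the limit
        on the finite set \<open>J\<close>, the other half to replacing \<open>X i\<close> by a
        transitive graph.\<close>
      have "\<forall>\<^sub>F i in sequentially. \<forall>H\<in>J. dist (hstar H (X i)) (f H) < \<epsilon> / 2"
        using J \<epsilon> lim by (intro eventually_ball_finite ballI tendstoD) auto
      then obtain i where i: "\<And>H. H \<in> J \<Longrightarrow> \<bar>hstar H (X i) - f H\<bar> < \<epsilon> / 2"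
        by (auto dest!: eventually_happens simp: dist_real_def)
      obtain G where G: "G \<in> bigraphs0" "edge_vertex_transitive G"
        "\<And>H. H \<in> J \<Longrightarrow> \<bar>h H G - hstar H (X i)\<bar> < \<epsilon> / 2"
        using transitive_approximation[OF X J, of "\<epsilon> / 2" i] \<epsilon> by auto
      have "\<bar>(\<lambda>H\<in>M2. h H G) H - f H\<bar> < \<epsilon>" if "H \<in> J" for H
      proof -
        have "H \<in> M2" using J that by blast
        then show ?thesis using G(3)[OF that] i[OF that] by (simp only: restrict_apply')
      qed
      then show "\<exists>g\<in>?S. \<forall>H\<in>J. \<bar>g H - f H\<bar> < \<epsilon>"
        using G(1,2) by (intro bexI[of _ "\<lambda>H\<in>M2. h H G"]) auto
    qed (rule f)
  qed
qed

end
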